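(* Let $\Omega \subseteq \mathbb{C}$ be a compact and simply connected set, not a single point, with $\Omega = \Omega^* := \{\overline{z} : z \in \Omega\}$, and let $\widetilde{\Phi} : \widehat{\mathbb{C}} \setminus \Omega \to \{ w \in \widehat{\mathbb{C}} : |w| > 1 \}$ be its exterior Riemann map, normalized by $\widetilde{\Phi}(\infty) = \infty$ and $\widetilde{\Phi}'(\infty) > 0$. Let $P(z) = \alpha z^n + \alpha_0$ with an integer $n \geq 2$, with $\alpha > 0$, and with $\alpha_0 \in \mathbb{R}$ lying to the left of $\Omega$. Then $E := P^{-1}(\Omega)$ is the disjoint union of $n$ simply connected compact sets. Moreover, put $$\mu := \Big( \frac{1}{\alpha\, \widetilde{\Phi}'(\infty)} \Big)^{\frac{1}{n}} > 0, \qquad U(w) := \big( w^n + \mu^n (\widetilde{\Phi} \circ P)(0) \big)^{\frac{1}{n}}, \qquad \mathcal{L} := \{ w \in \widehat{\mathbb{C}} : |U(w)| > \mu \}.$$ Then $\mathcal{L}$ is a lemniscatic domain and $$\Phi : \widehat{\mathbb{C}} \setminus E \to \mathcal{L}, \qquad \Phi(z) = z \Big( \frac{\mu^n}{z^n} \big[ (\widetilde{\Phi} \circ P)(z) - (\widetilde{\Phi} \circ P)(0) \big] \Big)^{\frac{1}{n}},$$ where the principal branch of the $n$th root is taken, is the lemniscatic map of $E$.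
   Context: $\widehat{\mathbb{C}} = \mathbb{C} \cup \{\infty\}$ is the extended complex plane. A compact set in $\mathbb{C}$ is called simply connected if it is connected and its complement in $\widehat{\mathbb{C}}$ is connected. The exterior Riemann map is a bijective conformal map; $\widetilde{\Phi}'(\infty)$ is defined by $\widetilde{\Phi}(z) = \widetilde{\Phi}'(\infty) z + \mathcal{O}(1)$ near infinity. "$\alpha_0 \in \mathbb{R}$ lies to the left of $\Omega$" means $\alpha_0 < x$ for every $x \in \Omega \cap \mathbb{R}$. A lemniscatic domain is a domain of the form $\mathcal{L} = \{ w \in \widehat{\mathbb{C}} : |U(w)| > \mu \}$ (containing $\infty$) with $U(w) = \prod_{j=1}^N (w - a_j)^{m_j}$, where $a_1, \dots, a_N \in \mathbb{C}$ are pairwise distinct, $m_1, \dots, m_N > 0$ are real with $\sum_{j=1}^N m_j = 1$, and $\mu > 0$. The function $U$ is in general multiple-valued, but $|U|$ is single-valued: $|U(w)| = \prod_j |w-a_j|^{m_j}$. In the theorem, $|U(w)| = |w^n + \mu^n(\widetilde{\Phi}\circ P)(0)|^{1/n}$. If $E = \bigcup_{j=1}^N E_j$ with $E_1, \dots, E_N \subseteq \mathbb{C}$ mutually exterior simply connected compact sets (none a single point), and $\mathcal{K} = \widehat{\mathbb{C}} \setminus E$, then by a theorem of Walsh there exist a unique lemniscatic domain $\mathcal{L}$ (with $N$ points $a_j$) and a unique bijective conformal map $\Phi : \mathcal{K} \to \mathcal{L}$ with $\Phi(z) = z + \mathcal{O}(1/z)$ for $z$ near infinity (in particular $\Phi(\infty)=\infty$).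 This $\Phi$ is called the lemniscatic map of $\mathcal{K}$ (or of $E$). The formula for $\Phi$ is understood at $z = 0$ and $z = \infty$ through its analytic (respectively meromorphic) extension, so that $\Phi(0) = 0$ and $\Phi(\infty) = \infty$. *)

theory Defs
  imports "HOL-Complex_Analysis.Complex_Analysis" "HOL-Library.Landau_Symbols"
begin

text \<open>The extended complex plane is the one-point compactification of the complex plane,
  with \<^term>\<open>None\<close> as the point at infinity.\<close>

abbreviation riemann_sphere :: "complex option topology" where
  "riemann_sphere \<equiv> Alexandroff_compactification euclidean"

text \<open>The library's \<^const>\<open>simply_connected\<close> is the homotopy notion; for compact plane sets the
  one used here is connectedness of the set and of its complement in the sphere. The empty set
  does not count as connected.\<close>

definition simply_connected_compactum :: "complex set \<Rightarrow> bool" where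
  "simply_connected_compactum K \<longleftrightarrow>
     compact K \<and> K \<noteq> {} \<and> connected K \<and> connectedin riemann_sphere (- Some ` K)"

text \<open>Holomorphic charts of the sphere: the identity around a finite point, and
  \<open>z \<mapsto> 1 / z\<close> around infinity. The value of a chart at the one point outside its
  domain is arbitrary, so holomorphy in charts must be combined with continuity.\<close>

definition sphere_chart :: "complex option \<Rightarrow> complex option \<Rightarrow> complex" where
  "sphere_chart p = (case p of
      Some _ \<Rightarrow> the
    | None \<Rightarrow> (\<lambda>q. case q of None \<Rightarrow> 0 | Some z \<Rightarrow> 1 / z))"

definition sphere_param :: "complex option \<Rightarrow> complex \<Rightarrow> complex option" where
  "sphere_param p = (case p of
      Some _ \<Rightarrow> Some
    | None \<Rightarrow> (\<lambda>z. if z = 0 then None else Some (1 / z)))"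

definition in_charts ::
  "(complex option \<Rightarrow> complex option) \<Rightarrow> complex option \<Rightarrow> complex \<Rightarrow> complex" where
  "in_charts f p = (\<lambda>z. sphere_chart (f p) (f (sphere_param p z)))"

definition bijective_conformal ::
  "complex option set \<Rightarrow> complex option set \<Rightarrow> (complex option \<Rightarrow> complex option) \<Rightarrow> bool" where
  "bijective_conformal K L f \<longleftrightarrow>
     openin riemann_sphere K \<and> openin riemann_sphere L \<and>
     bij_betw f K L \<and>
     continuous_map (subtopology riemann_sphere K) (subtopology riemann_sphere L) f \<and>
     (\<forall>p\<in>K. in_charts f p analytic_on {sphere_chart p p} \<and>
             deriv (in_charts f p) (sphere_chart p p) \<noteq> 0)"

text \<open>\<open>f(z) = c z + O(1)\<close> near infinity, which determines \<open>c = f'(\<infinity>)\<close>.\<close>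

definition has_deriv_at_infinity :: "(complex option \<Rightarrow> complex option) \<Rightarrow> complex \<Rightarrow> bool" where
  "has_deriv_at_infinity f c \<longleftrightarrow>
     (\<lambda>z. the (f (Some z)) - c * z) \<in> O[at_infinity](\<lambda>_. 1)"

text \<open>\<open>{w. V w > \<mu>}\<close> together with infinity.\<close>

definition sphere_superlevel :: "(complex \<Rightarrow> real) \<Rightarrow> real \<Rightarrow> complex option set" where
  "sphere_superlevel V \<mu> = insert None (Some ` {w. V w > \<mu>})"

definition exterior_riemann_map ::
  "complex set \<Rightarrow> (complex option \<Rightarrow> complex option) \<Rightarrow> bool" where
  "exterior_riemann_map K f \<longleftrightarrow>
     bijective_conformal (- Some ` K) (sphere_superlevel cmod 1) f \<and>
     f None = None \<and> (\<exists>c::real. c > 0 \<and> has_deriv_at_infinity f (of_real c))"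

text \<open>\<open>U(w) = (\<Prod>j. (w - a\<^sub>j) ^ m\<^sub>j)\<close> is multiple-valued, but only its modulus matters.\<close>

definition lemniscatic_domain :: "nat \<Rightarrow> complex option set \<Rightarrow> bool" where
  "lemniscatic_domain N L \<longleftrightarrow>
     openin riemann_sphere L \<and> connectedin riemann_sphere L \<and>
     (\<exists>(a :: nat \<Rightarrow> complex) (m :: nat \<Rightarrow> real) \<mu>.
        inj_on a {..<N} \<and> (\<forall>j<N. m j > 0) \<and> (\<Sum>j<N. m j) = 1 \<and> \<mu> > 0 \<and>
        L = sphere_superlevel (\<lambda>w. \<Prod>j<N. cmod (w - a j) powr m j) \<mu>)"

text \<open>For simply connected compact sets, ``mutually exterior'' means pairwise disjoint. By
  Walsh's theorem, \<open>L\<close> and \<open>f\<close> (on the complement of \<open>E\<close>) are determined by \<open>E\<close>.\<close>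

definition lemniscatic_map ::
  "complex set \<Rightarrow> complex option set \<Rightarrow> (complex option \<Rightarrow> complex option) \<Rightarrow> bool" where
  "lemniscatic_map E L f \<longleftrightarrow>
     (\<exists>N (F :: nat \<Rightarrow> complex set).
        disjoint_family_on F {..<N} \<and> E = (\<Union>j<N. F j) \<and>
        (\<forall>j<N. simply_connected_compactum (F j) \<and> (\<nexists>z. F j = {z})) \<and>
        lemniscatic_domain N L) \<and>
     bijective_conformal (- Some ` E) L f \<and> f None = None \<and>
     (\<lambda>z. the (f (Some z)) - z) \<in> O[at_infinity](\<lambda>z. 1 / z)"

end

theory Submission
  imports Defs "HOL-Computational_Algebra.Fundamental_Theorem_Algebra"
begin

text \<open>
  Since \<open>P\<close> is \<open>z\<^sup>n\<close> followed by a real affine map and \<open>\<Omega>\<close> avoids \<open>]-\<infinity>, \<alpha>\<^sub>0]\<close>, the preimage \<open>E\<close> consists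
  of \<open>n\<close> rotated copies of the image of \<open>\<Omega>\<close> under a branch of the \<open>n\<close>th root. On the complement of
  \<open>\<Omega>\<close> put \<open>h(\<zeta>) = (f(\<zeta>) - f(\<alpha>\<^sub>0)) / (\<zeta> - \<alpha>\<^sub>0)\<close>, where \<open>f\<close> is the exterior Riemann map, so that
  \<open>\<Phi>(z) = z (h(P z) / f'(\<infinity>))\<^bsup>1/n\<^esup>\<close>. The Schwarz lemma gives \<open>f(cnj z) = cnj (f z)\<close>; hence \<open>f\<close>
  preserves the upper and the lower half plane, and it increases on \<open>]-\<infinity>, \<alpha>\<^sub>0]\<close>. So \<open>h\<close> omits
  \<open>]-\<infinity>, 0]\<close>, which makes the principal root holomorphic. Bijectivity onto \<open>\<L>\<close> follows from that
  of \<open>f\<close> because \<open>\<Phi>(z)\<^sup>n = \<mu>\<^sup>n (f(P z) - f(\<alpha>\<^sub>0))\<close> and \<open>\<Phi>\<close> commutes with rotations by \<open>n\<close>th roots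
  of unity.
\<close>

section \<open>The Riemann sphere\<close>

lemma sphere_Compl_eq: "- Some ` K = insert None (Some ` (- K))"
  by (auto simp: image_iff intro: option.exhaust)

lemma openin_sphere_Compl_compact:
  assumes "compact K"
  shows "openin riemann_sphere (- Some ` K)"
  unfolding sphere_Compl_eq using assms
  by (auto simp: openin_Alexandroff_compactification compact_imp_closed Compl_eq_Diff_UNIV)

text \<open>Infinity lies in the closure of the finite part, since \<open>K\<close> and another
  compact set cannot cover the plane; so adding infinity keeps connectedness. Conversely, a
  disconnected \<open>- K\<close> has a bounded component \<open>B\<close>, and
  \<open>K \<union> B\<close> is compact, so \<open>B\<close> and the complement of
  \<open>K \<union> B\<close> separate the sphere complement.\<close>

lemma connectedin_sphere_Compl_iff:
  assumes "compact K"
  shows "connectedin riemann_sphere (- Some ` K) \<longleftrightarrow> connected (- K)"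
proof
  assume "connected (- K)"
  then have 1: "connectedin riemann_sphere (Some ` (- K))"
    using connectedin_continuous_map_image[OF continuous_map_Some] by (metis connectedin_iff_connected)
  have "None \<in> riemann_sphere closure_of (Some ` (- K))"
    unfolding in_closure_of
  proof (intro conjI allI impI)
    fix T assume "None \<in> T \<and> openin riemann_sphere T"
    then obtain C where "compact C" "T = insert None (Some ` (- C))"
      by (auto simp: openin_Alexandroff_compactification Compl_eq_Diff_UNIV)
    moreover have "C \<union> K \<noteq> UNIV"
      using \<open>compact C\<close> assms by (metis compact_Un not_compact_UNIV)
    ultimately show "\<exists>y. y \<in> Some ` (- K) \<and> y \<in> T" by auto
  qed auto
  then have "- Some ` K \<subseteq> riemann_sphere closure_of (Some ` (- K))"
    using closure_of_subset[of "Some ` (- K)" riemann_sphere] by (auto simp: sphere_Compl_eq)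
  then show "connectedin riemann_sphere (- Some ` K)"
    by (intro connectedin_intermediate_closure_of[OF 1]) (auto simp: sphere_Compl_eq)
next
  assume con: "connectedin riemann_sphere (- Some ` K)"
  show "connected (- K)"
  proof (rule ccontr)
    assume "\<not> connected (- K)"
    then obtain x y where xy: "x \<in> - K" "y \<in> - K"
        "connected_component_set (- K) x \<noteq> connected_component_set (- K) y"
      by (metis connected_component_eq_eq connected_iff_connected_component)
    \<comment> \<open>Two different components cannot both be unbounded, because \<open>K\<close> is
      bounded.\<close>
    then obtain b where b: "b \<in> - K" "bounded (connected_component_set (- K) b)"
      using cobounded_unique_unbounded_component[of "- K" x y] assms
      by (auto simp: compact_imp_bounded)
    define B where "B = connected_component_set (- K) b"
    have "open B" unfolding B_def using assms
      by (simp add: open_connected_component compact_imp_closed open_Compl)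
    have "B \<in> components (- K)" using b by (auto simp: B_def components_def)
    then have "closed (K \<union> B)"
      using assms closed_Un_complement_component compact_imp_closed by blast
    then have "compact (K \<union> B)"
      using assms b by (simp add: compact_eq_bounded_closed B_def)
    then have o2: "openin riemann_sphere (- Some ` (K \<union> B))"
      by (rule openin_sphere_Compl_compact)
    have o1: "openin riemann_sphere (Some ` B)" using \<open>open B\<close> by simp
    have "b \<in> B" "B \<subseteq> - K" using b by (auto simp: B_def connected_component_subset)
    then have "- Some ` K \<subseteq> Some ` B \<union> - Some ` (K \<union> B)"
      "Some ` B \<inter> - Some ` (K \<union> B) \<inter> - Some ` K = {}"
      "Some b \<in> Some ` B \<inter> - Some ` K" "None \<in> - Some ` (K \<union> B) \<inter> - Some ` K"
      by auto
    then show False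
      using con o1 o2 unfolding connectedin by blast
  qed
qed

section \<open>Maps fixing infinity and their germs there\<close>

lemma continuous_map_sphere_extend:
  assumes K: "compact K" and F: "continuous_on (- K) F"
    and lim: "filterlim F at_infinity at_infinity"
  shows "continuous_map (subtopology riemann_sphere (- Some ` K)) riemann_sphere (map_option F)"
  unfolding continuous_map_def
proof (intro conjI allI impI)
  have oK: "open (- K)" using K by (simp add: compact_imp_closed open_Compl)
  fix U assume "openin riemann_sphere U"
  then consider U' where "open U'" "U = Some ` U'"
    | C where "compact C" "U = insert None (Some ` (- C))"
    by (auto simp: openin_Alexandroff_compactification Compl_eq_Diff_UNIV)
  then have "openin riemann_sphere {x \<in> - Some ` K. map_option F x \<in> U}"
  proof cases
    case 1
    have "{x \<in> - Some ` K. map_option F x \<in> U} = Some ` ((- K) \<inter> F -` U')"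
      by (auto simp: 1 sphere_Compl_eq)
    moreover have "open ((- K) \<inter> F -` U')"
      using F oK 1 by (simp add: continuous_on_open_vimage Int_commute)
    ultimately show ?thesis by simp
  next
    case 2
    \<comment> \<open>\<open>W\<close> consists of \<open>K\<close> and the points that
      \<open>F\<close> sends into \<open>C\<close>; it is compact because \<open>F\<close> leaves
      every bounded set near infinity.\<close>
    define W where "W = - ((- K) \<inter> F -` (- C))"
    have eq: "{x \<in> - Some ` K. map_option F x \<in> U} = - Some ` W"
      by (auto simp: 2 sphere_Compl_eq W_def)
    have "open ((- K) \<inter> F -` (- C))"
      using F oK 2 by (simp add: continuous_on_open_vimage Int_commute compact_imp_closed open_Compl)
    then have cl: "closed W" unfolding W_def by (simp add: closed_def)
    obtain r where r: "C \<subseteq> ball 0 r"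
      using 2 by (metis bounded_subset_ballD compact_imp_bounded)
    \<comment> \<open>The criterion for divergence takes positive bounds only, and \<open>r\<close>
      need not be positive; hence the maximum with 1.\<close>
    have "\<forall>\<^sub>F z in at_infinity. norm (F z) \<ge> max r 1"
      using lim unfolding filterlim_at_infinity[OF order_refl] by (simp del: max.bounded_iff)
    then obtain b where b: "\<And>z. norm z \<ge> b \<Longrightarrow> norm (F z) \<ge> r"
      unfolding eventually_at_infinity by force
    have "W \<subseteq> K \<union> cball 0 b"
    proof
      fix z assume "z \<in> W"
      then consider "z \<in> K" | "F z \<in> ball 0 r" using r by (auto simp: W_def)
      then show "z \<in> K \<union> cball 0 b" using b[of z] by cases auto
    qed
    then have "bounded W" using K by (meson bounded_Un bounded_cball bounded_subset compact_imp_bounded)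
    with cl show ?thesis unfolding eq
      by (intro openin_sphere_Compl_compact) (simp add: compact_eq_bounded_closed)
  qed
  moreover have "topspace (subtopology riemann_sphere (- Some ` K)) = - Some ` K"
    by (auto simp: sphere_Compl_eq)
  ultimately show "openin (subtopology riemann_sphere (- Some ` K))
      {x \<in> topspace (subtopology riemann_sphere (- Some ` K)). map_option F x \<in> U}"
    by (simp add: openin_open_subtopology[OF openin_sphere_Compl_compact[OF K]] subset_iff)
qed (auto simp: sphere_Compl_eq split: option.splits)

text \<open>The germ of \<open>F\<close> at infinity, read in the chart \<open>z \<mapsto> 1 / z\<close> on both sides.\<close>

definition inversion_conj :: "(complex \<Rightarrow> complex) \<Rightarrow> complex \<Rightarrow> complex" where
  "inversion_conj F t = (if t = 0 then 0 else 1 / F (1 / t))"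

text \<open>The exterior of \<open>K\<close> seen in the chart at infinity. The origin is added by
  hand, since \<open>1 / 0 = 0\<close> would make its membership depend on whether 0 lies in
  \<open>K\<close>.\<close>

definition inversion_nhd :: "complex set \<Rightarrow> complex set" where
  "inversion_nhd K = {t. t = 0 \<or> 1 / t \<notin> K}"

lemma open_inversion_nhd:
  assumes "compact K"
  shows "open (inversion_nhd K)"
proof -
  obtain r where r: "r > 0" "K \<subseteq> ball 0 r"
    using assms by (metis bounded_subset_ballD compact_imp_bounded)
  have "inversion_nhd K = ball 0 (1 / r) \<union> ((- {0}) \<inter> (\<lambda>t. 1 / t) -` (- K))"
  proof -
    have "1 / t \<notin> K" if "norm t < 1 / r" "t \<noteq> 0" for t
    proof
      assume "1 / t \<in> K"
      then have "norm (1 / t) < r" using r by (auto simp: subset_iff)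
      then show False using that r by (simp add: norm_divide field_simps)
    qed
    then show ?thesis using r by (auto simp: inversion_nhd_def)
  qed
  moreover have "open ((- {0}) \<inter> (\<lambda>t::complex. 1 / t) -` (- K))"
  proof -
    have "continuous_on (- {0::complex}) (\<lambda>t. 1 / t)" by (intro continuous_intros) auto
    then show ?thesis
      using continuous_on_open_vimage[of "- {0::complex}" "\<lambda>t. 1 / t"] assms
      by (auto simp: Int_commute compact_imp_closed open_Compl)
  qed
  ultimately show ?thesis by auto
qed

text \<open>Removable singularity: the limit \<open>l\<close> makes the function continuous at 0,
  and it is holomorphic elsewhere.\<close>

lemma holomorphic_on_inversion_nhd:
  assumes K: "compact K" and F: "F holomorphic_on - K" and lim: "(F \<longlongrightarrow> l) at_infinity"
  shows "(\<lambda>t. if t = 0 then l else F (1 / t)) holomorphic_on inversion_nhd K"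
proof (rule no_isolated_singularity[of _ _ "{0}"])
  let ?g = "\<lambda>t. if t = 0 then l else F (1 / t)"
  have "(\<lambda>t. F (1 / t)) holomorphic_on (inversion_nhd K - {0})"
    by (rule holomorphic_on_compose_gen[of "\<lambda>t. 1 / t" _ F "- K", unfolded o_def, OF _ F])
       (auto simp: inversion_nhd_def intro!: holomorphic_intros)
  then show h: "?g holomorphic_on (inversion_nhd K - {0})"
    by (rule holomorphic_transform) auto
  show op: "open (inversion_nhd K)" using K by (rule open_inversion_nhd)
  have "(\<lambda>t. F (1 / t)) \<midarrow>0\<rightarrow> l"
    using lim lim_at_infinity_0[of F l] by (simp add: o_def inverse_eq_divide)
  then have "?g \<midarrow>0\<rightarrow> l"
    by (rule Lim_transform_eventually) (simp add: eventually_at_filter)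
  then have "isCont ?g 0" by (simp add: isCont_def)
  moreover have "continuous_on (inversion_nhd K - {0}) ?g"
    using h by (rule holomorphic_on_imp_continuous_on)
  ultimately show "continuous_on (inversion_nhd K) ?g"
    using op by (subst continuous_on_eq_continuous_at)
      (auto simp: continuous_on_eq_continuous_at open_delete)
qed simp

text \<open>The function \<open>z / F z\<close> tends to \<open>1 / c\<close>, so it extends
  holomorphically in the chart to some \<open>g\<close> with \<open>g 0 = 1 / c\<close>. Both claims
  follow from the factorization of \<open>inversion_conj F\<close> as
  \<open>t * g t\<close>.\<close>

lemma
  assumes K: "compact K" and F: "F holomorphic_on - K" and nz: "\<And>z. z \<notin> K \<Longrightarrow> F z \<noteq> 0"
    and lim: "((\<lambda>z. F z / z) \<longlongrightarrow> c) at_infinity" and c: "c \<noteq> 0"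
  shows inversion_conj_holomorphic: "inversion_conj F holomorphic_on inversion_nhd K"
    and inversion_conj_deriv: "(inversion_conj F has_field_derivative 1 / c) (at 0)"
proof -
  define g where "g = (\<lambda>t. if t = 0 then inverse c else 1 / t / F (1 / t))"
  have "((\<lambda>z. z / F z) \<longlongrightarrow> inverse c) at_infinity"
    using tendsto_inverse[OF lim c] by (simp add: inverse_eq_divide)
  moreover have "(\<lambda>z. z / F z) holomorphic_on - K"
    using F nz by (auto intro!: holomorphic_intros)
  ultimately have g: "g holomorphic_on inversion_nhd K"
    unfolding g_def using holomorphic_on_inversion_nhd[OF K, of "\<lambda>z. z / F z"] by simp
  have eq: "inversion_conj F = (\<lambda>t. t * g t)"
    by (auto simp: inversion_conj_def g_def fun_eq_iff)
  show h: "inversion_conj F holomorphic_on inversion_nhd K"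
    unfolding eq using g by (intro holomorphic_intros)
  have "0 \<in> inversion_nhd K" by (simp add: inversion_nhd_def)
  then have "g field_differentiable at 0"
    using g K holomorphic_on_imp_differentiable_at open_inversion_nhd by blast
  then obtain d where "(g has_field_derivative d) (at 0)" by (auto simp: field_differentiable_def)
  then have "((\<lambda>t. t * g t) has_field_derivative (1 * g 0 + d * 0)) (at 0)"
    by (intro DERIV_mult DERIV_ident)
  then show "(inversion_conj F has_field_derivative 1 / c) (at 0)"
    unfolding eq by (simp add: g_def inverse_eq_divide)
qed

section \<open>Compact sets that do not separate the plane\<close>

text \<open>A continuous injection on a compact set is a homeomorphism onto its image, and whether a
  compact set separates the plane is a topological invariant of that set.\<close>

lemma simply_connected_compactum_inj_image:
  assumes K: "simply_connected_compactum K" and s: "continuous_on K s" "inj_on s K"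
  shows "simply_connected_compactum (s ` K)"
proof -
  have K': "compact K" "K \<noteq> {}" "connected K" "connected (- K)"
    using K connectedin_sphere_Compl_iff by (auto simp: simply_connected_compactum_def)
  have cs: "compact (s ` K)" using K' s by (simp add: compact_continuous_image)
  have "K homeomorphic s ` K" using homeomorphic_compact K' s by blast
  then have "connected (- (s ` K))"
    using homotopy_eqv_separation homeomorphic_imp_homotopy_eqv K' cs by blast
  then show ?thesis
    using K' s cs by (simp add: simply_connected_compactum_def connectedin_sphere_Compl_iff
        connected_continuous_image)
qed

text \<open>Induction with Janiszewski's theorem, whose hypothesis of a connected intersection holds
  because the intersection is empty.\<close>

lemma connected_Compl_UN_disjoint:
  fixes F :: "'i \<Rightarrow> complex set"
  assumes "finite I" "disjoint_family_on F I" "\<And>i. i \<in> I \<Longrightarrow> compact (F i)"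
    "\<And>i. i \<in> I \<Longrightarrow> connected (- F i)"
  shows "connected (- (\<Union>i\<in>I. F i))"
  using assms
proof (induction I)
  case empty
  then show ?case by (simp add: connected_UNIV)
next
  case (insert i I)
  have "F i \<inter> (\<Union>i\<in>I. F i) = {}"
    using insert by (auto simp: disjoint_family_on_def)
  moreover have "connected (- (\<Union>i\<in>I. F i))"
    using insert by (intro insert.IH) (auto simp: disjoint_family_on_def)
  ultimately have "connected (- (F i \<union> (\<Union>i\<in>I. F i)))"
    using insert by (intro Janiszewski_connected) (auto intro!: compact_imp_closed compact_UN)
  then show ?case by simp
qed

section \<open>Lemniscatic domains defined by binomials\<close>

lemma binomial_factorization:
  fixes b :: complex
  assumes "n > 0" "b \<noteq> 0"
  obtains a where "inj_on a {..<n}" "\<And>w. w ^ n + b = (\<Prod>j<n. w - a j)"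
proof -
  define p where "p = monom (1 :: complex) n + [:b:]"
  have p: "poly p w = w ^ n + b" for w by (simp add: p_def poly_monom)
  have deg: "degree p = n" using assms by (simp add: p_def degree_add_eq_left degree_monom_eq)
  have lc: "lead_coeff p = 1" using assms unfolding deg by (simp add: p_def coeff_pCons split: nat.split)
  \<comment> \<open>The derivative can vanish only at 0, which is not a root because
    \<open>b \<noteq> 0\<close>.\<close>
  have "rsquarefree p"
    using assms by (auto simp: rsquarefree_roots p p_def pderiv_add pderiv_monom poly_monom pderiv_pCons power_0_left)
  from complex_poly_decompose_rsquarefree[OF this]
  have dec: "(\<Prod>z | poly p z = 0. [:- z, 1:]) = p" by (simp add: lc)
  \<comment> \<open>One \<open>n\<close>th root of \<open>- b\<close>; multiplication by it carries
    the roots of unity to the roots of \<open>p\<close> and so numbers them.\<close>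
  define c where "c = of_real (root n (norm (- b))) * cis (Arg (- b) / n)"
  have Z: "bij_betw (\<lambda>k. c * cis (2 * pi * real k / real n)) {..<n} {z. poly p z = 0}"
    using bij_betw_trans[OF Complex.bij_betw_roots_unity bij_betw_nth_root_unity[of "- b" n]] assms
    by (auto simp: o_def c_def p add_eq_0_iff2)
  have "w ^ n + b = (\<Prod>z | poly p z = 0. w - z)" for w
    using arg_cong[OF dec, of "\<lambda>q. poly q w"] by (simp add: p poly_prod)
  also have "\<dots> w = (\<Prod>j<n. w - c * cis (2 * pi * real j / real n))" for w
    by (rule prod.reindex_bij_betw[OF Z, symmetric])
  finally show ?thesis using Z that[of "\<lambda>k. c * cis (2 * pi * real k / real n)"] by (auto simp: bij_betw_def)
qed

lemma openin_sphere_superlevel: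
  assumes "continuous_on UNIV V" "bounded {w. V w \<le> \<mu>}"
  shows "openin riemann_sphere (sphere_superlevel V \<mu>)"
proof -
  have "closed {w. V w \<le> \<mu>}" using assms by (intro closed_Collect_le) auto
  moreover have "sphere_superlevel V \<mu> = - Some ` {w. V w \<le> \<mu>}"
    by (auto simp: sphere_superlevel_def sphere_Compl_eq)
  ultimately show ?thesis
    using assms by (simp add: openin_sphere_Compl_compact compact_eq_bounded_closed)
qed

text \<open>The centres are the \<open>n\<close> distinct roots of the binomial, all with exponent
  \<open>1 / n\<close>. Openness at infinity amounts to boundedness of the sublevel set: for
  \<open>cmod w > 1\<close>, \<open>cmod w\<close> is at most \<open>cmod w ^ n\<close>, which is
  bounded there.\<close>

lemma lemniscatic_domain_binomial:
  fixes b :: complex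
  assumes n: "n > 0" and b: "b \<noteq> 0" and "\<mu> > 0"
    and L: "L = sphere_superlevel (\<lambda>w. root n (cmod (w ^ n + b))) \<mu>"
    and con: "connectedin riemann_sphere L"
  shows "openin riemann_sphere L" "lemniscatic_domain n L"
proof -
  obtain a where a: "inj_on a {..<n}" "\<And>w. w ^ n + b = (\<Prod>j<n. w - a j)"
    using binomial_factorization[OF n b] by metis
  have "root n (cmod (w ^ n + b)) = (\<Prod>j<n. cmod (w - a j) powr (1 / n))" for w
  proof -
    have "root n x = x powr (1 / n)" if "x \<ge> 0" for x :: real
      using that n by (cases "x = 0") (auto simp: root_powr_inverse inverse_eq_divide)
    then have "root n (cmod (w ^ n + b)) = (\<Prod>j<n. cmod (w - a j)) powr (1 / n)"
      by (simp add: a(2) prod_norm)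
    also have "\<dots> = (\<Prod>j<n. cmod (w - a j) powr (1 / n))" by (simp add: prod_powr_distrib)
    finally show ?thesis .
  qed
  then have L': "L = sphere_superlevel (\<lambda>w. \<Prod>j<n. cmod (w - a j) powr (1 / n)) \<mu>"
    by (simp add: L)
  have "cmod w \<le> max 1 (\<mu> ^ n + cmod b)" if "root n (cmod (w ^ n + b)) \<le> \<mu>" for w
  proof (cases "cmod w \<le> 1")
    case False
    have "cmod (w ^ n + b) = root n (cmod (w ^ n + b)) ^ n" using n by simp
    also have "\<dots> \<le> \<mu> ^ n" using that n by (intro power_mono) auto
    finally have "cmod w ^ n \<le> \<mu> ^ n + cmod b"
      using norm_triangle_ineq2[of "w ^ n" "- b"] by (simp add: norm_power)
    moreover have "cmod w \<le> cmod w ^ n" using False n by (intro self_le_power) auto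
    ultimately show ?thesis by simp
  qed simp
  then show op: "openin riemann_sphere L"
    unfolding L using n
    by (intro openin_sphere_superlevel boundedI[where B="max 1 (\<mu> ^ n + cmod b)"])
      (auto intro!: continuous_intros)
  show "lemniscatic_domain n L"
    unfolding lemniscatic_domain_def using op con L' a(1) \<open>\<mu> > 0\<close> n
    by (intro conjI exI[of _ a] exI[of _ "\<lambda>_. 1 / n"] exI[of _ \<mu>]) auto
qed

section \<open>Conformal maps of the sphere and their finite parts\<close>

lemma filterlim_at_infinity_of_quotient:
  fixes F :: "complex \<Rightarrow> complex"
  assumes "((\<lambda>z. F z / z) \<longlongrightarrow> c) at_infinity" "c \<noteq> 0"
  shows "filterlim F at_infinity at_infinity"
proof -
  have "filterlim (\<lambda>z. F z / z * z) at_infinity at_infinity"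
    using assms by (intro tendsto_mult_filterlim_at_infinity[OF _ _ filterlim_ident]) auto
  then show ?thesis
    by (rule filterlim_mono_eventually[OF _ order_refl order_refl])
       (use eventually_not_equal_at_infinity[of "0::complex"] in \<open>rule eventually_mono, simp\<close>)
qed

text \<open>At finite points the derivative is nonzero by injectivity. At infinity the map in charts
  is \<open>inversion_conj F\<close>, with derivative \<open>1 / c\<close>.\<close>

lemma bijective_conformal_extend:
  assumes K: "compact K" and F: "F holomorphic_on - K" and inj: "inj_on F (- K)"
    and lim: "((\<lambda>z. F z / z) \<longlongrightarrow> c) at_infinity" "c \<noteq> 0"
    and L: "openin riemann_sphere L" "L = insert None (Some ` F ` (- K))"
  shows "bijective_conformal (- Some ` K) L (map_option F)"
  unfolding bijective_conformal_def
proof (intro conjI ballI)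
  have op: "open (- K)" using K by (simp add: compact_imp_closed open_Compl)
  have inf: "filterlim F at_infinity at_infinity"
    using lim by (rule filterlim_at_infinity_of_quotient)
  show "openin riemann_sphere (- Some ` K)" using K by (rule openin_sphere_Compl_compact)
  show "bij_betw (map_option F) (- Some ` K) L"
    using inj unfolding bij_betw_def sphere_Compl_eq L by (auto simp: inj_on_def image_iff)
  show "continuous_map (subtopology riemann_sphere (- Some ` K)) (subtopology riemann_sphere L) (map_option F)"
    using continuous_map_sphere_extend[OF K holomorphic_on_imp_continuous_on[OF F] inf]
    by (auto simp: continuous_map_in_subtopology sphere_Compl_eq L)
  have "in_charts (map_option F) p analytic_on {sphere_chart p p} \<and>
     deriv (in_charts (map_option F) p) (sphere_chart p p) \<noteq> 0" if p: "p \<in> - Some ` K" for p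
  proof (cases p)
    case (Some z)
    then have "z \<in> - K" using p by auto
    moreover have "in_charts (map_option F) p = F"
      by (auto simp: in_charts_def sphere_chart_def sphere_param_def Some)
    ultimately show ?thesis
      using F op inj holomorphic_injective_imp_regular[OF F op inj]
      by (auto simp: Some sphere_chart_def analytic_at)
  next
    case None
    have eq: "in_charts (map_option F) p = inversion_conj F"
      by (auto simp: in_charts_def sphere_chart_def sphere_param_def None inversion_conj_def)
    have "\<forall>\<^sub>F z in at_infinity. 1 \<le> norm (F z)"
      using inf unfolding filterlim_at_infinity[OF order_refl] by simp
    then obtain b where b: "\<And>z. norm z \<ge> b \<Longrightarrow> 1 \<le> norm (F z)"
      unfolding eventually_at_infinity by auto
    obtain r where r: "K \<subseteq> ball 0 r"
      using K by (metis bounded_subset_ballD compact_imp_bounded)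
    \<comment> \<open>\<open>F\<close> may vanish somewhere outside \<open>K\<close>. Only the germ
      at infinity matters, so \<open>K\<close> is enlarged to a disc outside which \<open>F\<close>
      has no zero.\<close>
    define C where "C = cball (0::complex) (max b r)"
    have "K \<subseteq> C" using r by (auto simp: C_def)
    then have "F holomorphic_on - C" by (intro holomorphic_on_subset[OF F]) auto
    moreover have "F z \<noteq> 0" if "z \<notin> C" for z
      using b[of z] that by (auto simp: C_def le_max_iff_disj)
    ultimately have C: "compact C" "F holomorphic_on - C" "\<And>z. z \<notin> C \<Longrightarrow> F z \<noteq> 0"
      by (auto simp: C_def)
    have "0 \<in> inversion_nhd C" by (simp add: inversion_nhd_def)
    then have "inversion_conj F analytic_on {0}"
      using inversion_conj_holomorphic[OF C lim] open_inversion_nhd[OF C(1)] analytic_at by blast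
    moreover have "deriv (inversion_conj F) 0 = 1 / c"
      using inversion_conj_deriv[OF C lim] by (rule DERIV_imp_deriv)
    ultimately show ?thesis using lim(2) unfolding eq by (simp add: None sphere_chart_def)
  qed
  then show "in_charts (map_option F) p analytic_on {sphere_chart p p}"
    "deriv (in_charts (map_option F) p) (sphere_chart p p) \<noteq> 0" if "p \<in> - Some ` K" for p
    using that by auto
qed (fact L)

text \<open>By injectivity only infinity is sent to infinity, so at every finite point both charts
  are the identity chart.\<close>

lemma
  assumes bc: "bijective_conformal (- Some ` K) (insert None (Some ` M)) h" and inf: "h None = None"
    and K: "compact K"
  shows bijective_conformal_finite_bij: "bij_betw (\<lambda>z. the (h (Some z))) (- K) M"
    and bijective_conformal_finite_holomorphic: "(\<lambda>z. the (h (Some z))) holomorphic_on - K"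
proof -
  let ?f = "\<lambda>z. the (h (Some z))"
  have bij: "bij_betw h (insert None (Some ` (- K))) (insert None (Some ` M))"
    using bc by (simp add: bijective_conformal_def sphere_Compl_eq)
  have "bij_betw h (Some ` (- K)) (Some ` M)"
    using bij_betw_DiffI[OF bij, of "{None}" "{None}"] inf by (auto simp: bij_betw_def)
  from bij_betw_trans[OF bij_betw_trans[OF _ this], of Some "- K" the M]
  show "bij_betw ?f (- K) M" by (auto simp: o_def bij_betw_def inj_on_def image_comp)
  show "?f holomorphic_on - K"
    unfolding holomorphic_on_def
  proof
    fix z assume z: "z \<in> - K"
    then have "h (Some z) \<in> Some ` M"
      using bij_betw_apply[OF \<open>bij_betw h (Some ` (- K)) (Some ` M)\<close>] by blast
    then have "h (Some z) \<noteq> None" by auto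
    then have "in_charts h (Some z) = ?f"
      by (auto simp: in_charts_def sphere_chart_def sphere_param_def)
    moreover have "Some z \<in> - Some ` K" using z by auto
    ultimately have "?f analytic_on {z}"
      using bc by (auto simp: bijective_conformal_def sphere_chart_def dest!: bspec[of _ _ "Some z"])
    then show "?f field_differentiable at z within - K"
      by (meson analytic_on_imp_differentiable_at field_differentiable_at_within singletonI)
  qed
qed

lemma has_deriv_at_infinity_tendsto:
  assumes "has_deriv_at_infinity h c"
  shows "((\<lambda>z. the (h (Some z)) / z) \<longlongrightarrow> c) at_infinity"
proof -
  let ?f = "\<lambda>z. the (h (Some z))"
  have "(\<lambda>z. 1 :: complex) \<in> o[at_infinity](\<lambda>z. z)"
    by (rule smalloI_tendsto)
       (auto intro!: tendsto_divide_0[OF tendsto_const filterlim_ident] eventually_not_equal_at_infinity)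
  then have "(\<lambda>z. ?f z - c * z) \<in> o[at_infinity](\<lambda>z. z)"
    using assms unfolding has_deriv_at_infinity_def by (rule landau_o.big_small_trans[rotated])
  then have "((\<lambda>z. (?f z - c * z) / z) \<longlongrightarrow> 0) at_infinity" by (rule smalloD_tendsto)
  then have "((\<lambda>z. (?f z - c * z) / z + c) \<longlongrightarrow> 0 + c) at_infinity" by (intro tendsto_intros)
  then have "((\<lambda>z. (?f z - c * z) / z + c) \<longlongrightarrow> c) at_infinity" by simp
  then show ?thesis
    by (rule filterlim_mono_eventually[OF _ order_refl order_refl])
       (use eventually_not_equal_at_infinity[of "0::complex"] in
         \<open>rule eventually_mono, simp add: diff_divide_distrib\<close>)
qed

text \<open>The imaginary parts of points of \<Omega> form a connected set symmetric about 0, which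
  therefore contains 0.\<close>

lemma symmetric_connected_real_point:
  assumes "cnj ` \<Omega> = \<Omega>" "connected \<Omega>" "\<Omega> \<noteq> {}"
  obtains x :: real where "of_real x \<in> \<Omega>"
proof -
  obtain z where z: "z \<in> \<Omega>" using assms by auto
  then have "cnj z \<in> \<Omega>" using assms by blast
  with z have "Im z \<in> Im ` \<Omega>" "- Im z \<in> Im ` \<Omega>" by (auto simp: image_iff intro: bexI[of _ "cnj z"])
  moreover have "connected (Im ` \<Omega>)" using assms(2) by (intro connected_continuous_image continuous_intros)
  ultimately have "0 \<in> Im ` \<Omega>"
    using connectedD_interval[of "Im ` \<Omega>" "Im z" "- Im z" 0] connectedD_interval[of "Im ` \<Omega>" "- Im z" "Im z" 0]
    by (cases "Im z \<le> 0") auto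
  then obtain w where "w \<in> \<Omega>" "Im w = 0" by auto
  then have "of_real (Re w) \<in> \<Omega>" by (metis complex_of_real_def complex_surj)
  then show ?thesis by (rule that)
qed

section \<open>Symmetric exterior maps\<close>

text \<open>Here \<open>f\<close> is the finite part of an exterior Riemann map; its behaviour at
  infinity is recorded by \<open>lim\<close> alone. The base point \<open>x\<^sub>0\<close> is real
  so that translating by it commutes with conjugation.\<close>

locale symmetric_exterior_map =
  fixes \<Omega> :: "complex set" and f :: "complex \<Rightarrow> complex" and c x\<^sub>0 :: real
  assumes compact: "compact \<Omega>" and sym: "cnj ` \<Omega> = \<Omega>" and x0: "of_real x\<^sub>0 \<in> \<Omega>"
    and holo: "f holomorphic_on - \<Omega>" and bij: "bij_betw f (- \<Omega>) {w. 1 < cmod w}"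
    and c_pos: "c > 0" and lim: "((\<lambda>z. f z / z) \<longlongrightarrow> of_real c) at_infinity"
begin

text \<open>The point \<open>x\<^sub>0\<close> of \<open>\<Omega>\<close> is moved to the origin, so that the inversion maps the whole
  exterior of \<open>\<Omega>\<close> into the plane and \<open>\<phi>\<close> becomes a conformal map onto the unit disc.\<close>

definition \<phi> :: "complex \<Rightarrow> complex" where
  "\<phi> = inversion_conj (\<lambda>z. f (z + of_real x\<^sub>0))"

definition V :: "complex set" where
  "V = inversion_nhd ((\<lambda>z. z - of_real x\<^sub>0) ` \<Omega>)"

lemma cnj_in_iff: "cnj z \<in> \<Omega> \<longleftrightarrow> z \<in> \<Omega>"
  using sym by (metis complex_cnj_cnj image_eqI)

lemma inj: "z \<notin> \<Omega> \<Longrightarrow> w \<notin> \<Omega> \<Longrightarrow> f z = f w \<longleftrightarrow> z = w"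
  using bij by (auto simp: bij_betw_def inj_on_def)

lemma norm_gt_1: "z \<notin> \<Omega> \<Longrightarrow> 1 < cmod (f z)"
  using bij by (auto simp: bij_betw_def)

lemma in_translate_iff: "z \<in> (\<lambda>z. z - of_real x\<^sub>0) ` \<Omega> \<longleftrightarrow> z + of_real x\<^sub>0 \<in> \<Omega>"
  by (force simp: image_iff algebra_simps)

lemma V_iff: "t \<in> V \<longleftrightarrow> t = 0 \<or> 1 / t + of_real x\<^sub>0 \<notin> \<Omega>"
  by (simp add: V_def inversion_nhd_def in_translate_iff)

lemma \<phi>_eq: "\<phi> t = (if t = 0 then 0 else 1 / f (1 / t + of_real x\<^sub>0))"
  by (simp add: \<phi>_def inversion_conj_def)

lemma compact_translate: "compact ((\<lambda>z. z - of_real x\<^sub>0) ` \<Omega>)"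
  using compact by (auto intro!: compact_continuous_image continuous_intros)

lemma open_V: "open V"
  unfolding V_def using compact_translate by (rule open_inversion_nhd)

lemma translate_at_infinity:
  "filterlim (\<lambda>z::complex. z + a) at_infinity at_infinity"
  by (rule tendsto_add_filterlim_at_infinity'[OF filterlim_ident tendsto_const])

lemma lim_translate: "((\<lambda>z. f (z + of_real x\<^sub>0) / z) \<longlongrightarrow> of_real c) at_infinity"
proof -
  have 1: "((\<lambda>z. f (z + of_real x\<^sub>0) / (z + of_real x\<^sub>0)) \<longlongrightarrow> of_real c) at_infinity"
    using filterlim_compose[OF lim translate_at_infinity] .
  have "((\<lambda>z::complex. 1 + of_real x\<^sub>0 / z) \<longlongrightarrow> 1 + 0) at_infinity"
    by (intro tendsto_intros tendsto_divide_0[OF tendsto_const filterlim_ident])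
  from tendsto_mult[OF 1 this]
  have "((\<lambda>z. f (z + of_real x\<^sub>0) / (z + of_real x\<^sub>0) * (1 + of_real x\<^sub>0 / z)) \<longlongrightarrow> of_real c) at_infinity"
    by simp
  then show ?thesis
  proof (rule Lim_transform_eventually)
    show "\<forall>\<^sub>F z in at_infinity. f (z + of_real x\<^sub>0) / (z + of_real x\<^sub>0) * (1 + of_real x\<^sub>0 / z)
        = f (z + of_real x\<^sub>0) / z"
      using eventually_not_equal_at_infinity[of 0] eventually_not_equal_at_infinity[of "- of_real x\<^sub>0"]
    proof eventually_elim
      case (elim z)
      then have "z + of_real x\<^sub>0 \<noteq> 0" by (metis add_eq_0_iff2)
      moreover have "1 + of_real x\<^sub>0 / z = (z + of_real x\<^sub>0) / z"
        using elim by (simp add: add_divide_distrib)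
      ultimately show ?case by simp
    qed
  qed
qed

lemma \<phi>_holo: "\<phi> holomorphic_on V"
  and \<phi>_deriv: "(\<phi> has_field_derivative 1 / of_real c) (at 0)"
proof -
  have "(\<lambda>z. f (z + of_real x\<^sub>0)) holomorphic_on - (\<lambda>z. z - of_real x\<^sub>0) ` \<Omega>"
    by (rule holomorphic_on_compose_gen[of "\<lambda>z. z + of_real x\<^sub>0" _ f "- \<Omega>", unfolded o_def, OF _ holo])
       (auto intro!: holomorphic_intros simp: in_translate_iff simp del: image_iff)
  moreover have "f (z + of_real x\<^sub>0) \<noteq> 0" if "z \<notin> (\<lambda>z. z - of_real x\<^sub>0) ` \<Omega>" for z
    using norm_gt_1[of "z + of_real x\<^sub>0"] that by (force simp: in_translate_iff)
  ultimately show "\<phi> holomorphic_on V" "(\<phi> has_field_derivative 1 / of_real c) (at 0)"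
    unfolding \<phi>_def V_def using compact_translate lim_translate c_pos
    by (auto intro!: inversion_conj_holomorphic inversion_conj_deriv)
qed

lemma \<phi>_bij: "bij_betw \<phi> V (ball 0 1)"
proof -
  have nz: "f (1 / t + of_real x\<^sub>0) \<noteq> 0" if "t \<in> V" "t \<noteq> 0" for t
    using norm_gt_1[of "1 / t + of_real x\<^sub>0"] that by (force simp: V_iff)
  have "inj_on \<phi> V"
    using nz inj by (auto simp: inj_on_def \<phi>_eq V_iff split: if_splits)
  moreover have "\<phi> t \<in> ball 0 1" if "t \<in> V" for t
    using norm_gt_1[of "1 / t + of_real x\<^sub>0"] that
    by (auto simp: \<phi>_eq V_iff norm_divide divide_less_eq)
  moreover have "\<exists>t\<in>V. u = \<phi> t" if "u \<in> ball 0 1" for u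
  proof (cases "u = 0")
    case True
    then show ?thesis by (auto simp: V_iff \<phi>_eq intro!: bexI[of _ 0])
  next
    case False
    then have "1 / u \<in> {w. 1 < cmod w}" using that by (simp add: norm_divide field_simps)
    then obtain z where z: "z \<notin> \<Omega>" "1 / u = f z" using bij by (auto simp: bij_betw_def)
    \<comment> \<open>As \<open>x\<^sub>0\<close> belongs to \<Omega>, the inversion about it sends
      every exterior point to a finite point of \<open>V\<close>.\<close>
    have "z \<noteq> of_real x\<^sub>0" using z x0 by auto
    moreover have "u = 1 / f z" using z(2) by (metis div_by_1 divide_divide_eq_right mult_1)
    ultimately show ?thesis
      using z by (intro bexI[of _ "1 / (z - of_real x\<^sub>0)"]) (auto simp: V_iff \<phi>_eq field_simps)
  qed
  ultimately show ?thesis unfolding bij_betw_def by blast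
qed

section \<open>The inverse disc map and conjugation symmetry\<close>

definition \<psi> :: "complex \<Rightarrow> complex" where "\<psi> = inv_into V \<phi>"

lemma \<psi>_\<phi>: "t \<in> V \<Longrightarrow> \<psi> (\<phi> t) = t"
  using \<phi>_bij by (simp add: \<psi>_def bij_betw_inv_into_left)

lemma \<phi>_\<psi>: "cmod u < 1 \<Longrightarrow> \<phi> (\<psi> u) = u"
  using \<phi>_bij by (simp add: \<psi>_def bij_betw_inv_into_right)

lemma \<psi>_in: "cmod u < 1 \<Longrightarrow> \<psi> u \<in> V"
  using \<phi>_bij by (auto simp: \<psi>_def bij_betw_def inv_into_into)

lemma \<psi>_0: "\<psi> 0 = 0"
  using \<psi>_\<phi>[of 0] by (simp add: \<phi>_eq V_iff)

text \<open>The holomorphic inverse function theorem supplies \<open>g\<close>, which agrees with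
  \<psi> on the disc; its derivative at 0 is the reciprocal of \<open>1 / c\<close>.\<close>

lemma \<psi>_holo: "\<psi> holomorphic_on ball 0 1"
  and \<psi>_deriv: "(\<psi> has_field_derivative of_real c) (at 0)"
proof -
  have "inj_on \<phi> V" "\<phi> ` V = ball 0 1" using \<phi>_bij by (auto simp: bij_betw_def)
  then obtain g where g: "g holomorphic_on ball 0 1"
      "\<And>z. z \<in> V \<Longrightarrow> deriv \<phi> z * deriv g (\<phi> z) = 1" "\<And>z. z \<in> V \<Longrightarrow> g (\<phi> z) = z"
    using holomorphic_has_inverse[OF \<phi>_holo open_V] by metis
  have eq: "\<psi> u = g u" if "u \<in> ball 0 1" for u
    using that g(3)[OF \<psi>_in] \<phi>_\<psi> by simp
  then show h: "\<psi> holomorphic_on ball 0 1"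
    using holomorphic_cong[OF refl, of "ball 0 1" \<psi> g] g(1) by auto
  have "deriv \<phi> 0 = 1 / of_real c" by (rule DERIV_imp_deriv[OF \<phi>_deriv])
  moreover have "\<phi> 0 = 0" "0 \<in> V" by (auto simp: \<phi>_eq V_iff)
  ultimately have "deriv g 0 = of_real c" using g(2)[of 0] c_pos by auto
  moreover have "\<forall>\<^sub>F u in nhds 0. \<psi> u = g u"
    using eventually_nhds_in_open[of "ball 0 1" "0::complex"] eq by (auto elim: eventually_mono)
  then have "deriv \<psi> 0 = deriv g 0" by (rule deriv_cong_ev) simp
  moreover have "(\<psi> has_field_derivative deriv \<psi> 0) (at 0)"
    using h by (rule holomorphic_derivI) auto
  ultimately show "(\<psi> has_field_derivative of_real c) (at 0)" by simp
qed

lemma cnj_in_V: "t \<in> V \<Longrightarrow> cnj t \<in> V"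
  using cnj_in_iff[of "1 / t + of_real x\<^sub>0"] by (auto simp: V_iff)

text \<open>By the Schwarz lemma, the automorphism \<open>cnj \<circ> \<phi> \<circ> cnj \<circ> \<psi>\<close> of the disc is the identity,
  since it has derivative \<open>1\<close> at its fixed point \<open>0\<close>.\<close>

lemma \<phi>_cnj:
  assumes "t \<in> V"
  shows "\<phi> (cnj t) = cnj (\<phi> t)"
proof -
  define \<phi>' where "\<phi>' = cnj \<circ> \<phi> \<circ> cnj"
  define \<kappa> where "\<kappa> = \<phi>' \<circ> \<psi>"
  have "cnj ` V = V" using cnj_in_V by (force simp: image_iff intro: bexI[of _ "cnj _"])
  then have h': "\<phi>' holomorphic_on V"
    unfolding \<phi>'_def by (intro holomorphic_on_compose_cnj_cnj \<phi>_holo open_V) (simp add: \<phi>_holo)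
  have "\<psi> ` ball 0 1 \<subseteq> V" using \<psi>_in by auto
  then have h: "\<kappa> holomorphic_on ball 0 1"
    unfolding \<kappa>_def using \<psi>_holo h' by (intro holomorphic_on_compose_gen)
  \<comment> \<open>The derivative \<open>1 / c\<close> is real, hence unchanged by conjugation;
    composing with \<psi> multiplies it by \<open>c\<close> and gives 1.\<close>
  have "(\<phi>' has_field_derivative cnj (1 / of_real c)) (at (cnj 0))"
    unfolding \<phi>'_def using \<phi>_deriv by (intro has_field_derivative_cnj_cnj) auto
  then have "(\<phi>' has_field_derivative 1 / of_real c) (at (\<psi> 0))" by (simp add: \<psi>_0)
  from DERIV_chain[OF this \<psi>_deriv] have d: "deriv \<kappa> 0 = 1"
    unfolding \<kappa>_def using c_pos by (intro DERIV_imp_deriv) simp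
  have no: "cmod (\<kappa> u) < 1" if "cmod u < 1" for u
    using \<phi>_bij cnj_in_V[OF \<psi>_in[OF that]] by (auto simp: \<kappa>_def \<phi>'_def bij_betw_def)
  have k0: "\<kappa> 0 = 0" by (simp add: \<kappa>_def \<phi>'_def \<psi>_0 \<phi>_eq)
  from Schwarz_Lemma(3)[OF h k0 no, of 0] d obtain b where b: "\<And>z. cmod z < 1 \<Longrightarrow> \<kappa> z = b * z"
    by auto
  have "deriv \<kappa> 0 = deriv (\<lambda>z. b * z) 0"
    by (rule deriv_cong_ev)
      (use eventually_nhds_in_open[of "ball 0 1" "0::complex"] b in \<open>auto elim: eventually_mono\<close>)
  then have "b = 1" using d by simp
  moreover have "cmod (\<phi> t) < 1" using \<phi>_bij assms by (auto simp: bij_betw_def)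
  ultimately have "\<kappa> (\<phi> t) = \<phi> t" using b by simp
  then have "cnj (\<phi> (cnj t)) = \<phi> t" using \<psi>_\<phi>[OF assms] by (simp add: \<kappa>_def \<phi>'_def)
  then show ?thesis by (metis complex_cnj_cnj)
qed

lemma f_cnj:
  assumes "z \<notin> \<Omega>"
  shows "f (cnj z) = cnj (f z)"
proof -
  define t where "t = 1 / (z - of_real x\<^sub>0)"
  have "z \<noteq> of_real x\<^sub>0" using assms x0 by auto
  then have t: "t \<noteq> 0" "1 / t + of_real x\<^sub>0 = z" by (auto simp: t_def)
  then have "t \<in> V" using assms by (simp add: V_iff)
  from \<phi>_cnj[OF this] t have "1 / f (1 / cnj t + of_real x\<^sub>0) = cnj (1 / f z)" by (simp add: \<phi>_eq)
  moreover have "1 / cnj t + of_real x\<^sub>0 = cnj z" using t by (metis complex_cnj_add complex_cnj_divide complex_cnj_one complex_cnj_complex_of_real)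
  ultimately show ?thesis by (simp add: divide_simps split: if_splits)
qed

lemma f_real: "of_real x \<notin> \<Omega> \<Longrightarrow> f (of_real x) = of_real (Re (f (of_real x)))"
  using f_cnj[of "of_real x"] by (metis complex_cnj_complex_of_real Reals_cnj_iff of_real_Re)

lemma \<psi>_real_imp_real:
  assumes "cmod u < 1" "Im (\<psi> u) = 0"
  shows "Im u = 0"
proof -
  have "cnj (\<psi> u) = \<psi> u" using assms by (simp add: complex_eq_iff)
  then have "cnj u = u" using \<phi>_cnj[OF \<psi>_in] \<phi>_\<psi> assms by metis
  then show ?thesis by (metis Reals_cnj_iff complex_is_Real_iff)
qed

text \<open>The half disc is connected and \<open>Im \<circ> \<psi>\<close> has no zero there, so it has the sign that it
  has close to \<open>0\<close>.\<close>

lemma Im_\<psi>_pos: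
  assumes "cmod u < 1" "Im u > 0"
  shows "Im (\<psi> u) > 0"
proof (rule ccontr)
  assume neg: "\<not> Im (\<psi> u) > 0"
  define D where "D = ball (0::complex) 1 \<inter> {z. Im z > 0}"
  have "connected D"
    unfolding D_def by (intro convex_connected convex_Int convex_ball convex_halfspace_Im_gt)
  moreover have "continuous_on D (\<lambda>z. Im (\<psi> z))"
    using continuous_on_subset[OF holomorphic_on_imp_continuous_on[OF \<psi>_holo], of D]
    by (intro continuous_intros) (auto simp: D_def)
  ultimately have con: "connected ((\<lambda>z. Im (\<psi> z)) ` D)" by (intro connected_continuous_image)
  have nz: "0 \<notin> (\<lambda>z. Im (\<psi> z)) ` D" using \<psi>_real_imp_real by (force simp: D_def)
  have nonpos: "Im (\<psi> z) \<le> 0" if "z \<in> D" for z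
  proof (rule ccontr)
    assume "\<not> Im (\<psi> z) \<le> 0"
    then have "0 \<in> (\<lambda>z. Im (\<psi> z)) ` D"
      using connectedD_interval[OF con, of "Im (\<psi> u)" "Im (\<psi> z)" 0] that assms neg
      by (auto simp: D_def)
    with nz show False by simp
  qed
  \<comment> \<open>Along the positive imaginary axis the real part of this quotient is
    \<open>Im (\<psi> (\<i> * x)) / x\<close>. If \<psi> maps the half disc into the closed lower
    half plane, then \<open>c\<close> is a limit of nonpositive numbers.\<close>
  have "((\<lambda>h. \<psi> h / h) \<longlongrightarrow> of_real c) (at 0)"
    using \<psi>_deriv by (simp add: DERIV_def \<psi>_0)
  moreover have "filterlim (\<lambda>x::real. \<i> * of_real x) (at 0) (at_right 0)"
    unfolding filterlim_at
    by (intro conjI tendsto_eq_intros) (auto simp: eventually_at_filter intro!: tendsto_eq_intros)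
  ultimately have "((\<lambda>x::real. \<psi> (\<i> * of_real x) / (\<i> * of_real x)) \<longlongrightarrow> of_real c) (at_right 0)"
    by (rule filterlim_compose)
  moreover have "Re (w / (\<i> * of_real x)) = Im w / x" for w and x :: real
    by (simp add: Re_divide power2_eq_square)
  ultimately have "((\<lambda>x. Im (\<psi> (\<i> * of_real x)) / x) \<longlongrightarrow> c) (at_right 0)"
    using tendsto_Re by fastforce
  moreover have "\<forall>\<^sub>F x in at_right 0. Im (\<psi> (\<i> * of_real x)) / x \<le> 0"
  proof -
    have "\<forall>\<^sub>F x in at_right (0::real). x \<in> {0<..<1}"
      by (rule eventually_at_right_real) simp
    then show ?thesis
    proof eventually_elim
      case (elim x)
      then have "\<i> * of_real x \<in> D" by (auto simp: D_def norm_mult)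
      from nonpos[OF this] elim show ?case by (simp add: divide_nonpos_pos)
    qed
  qed
  ultimately have "c \<le> 0" by (rule tendsto_upperbound) simp
  with c_pos show False by simp
qed

lemma Im_divide_1: "Im (1 / z) = - Im z / (cmod z)\<^sup>2"
  by (simp add: Im_divide cmod_power2)

text \<open>Inversion swaps the half planes and is applied twice: \<open>z\<close> above the axis
  gives \<open>t\<close> below it, then \<open>\<phi> t\<close> below it, then
  \<open>f z = 1 / \<phi> t\<close> above it. For \<open>\<phi> t\<close>,
  \<open>Im_\<psi>_pos\<close> excludes the upper half plane and conjugation symmetry excludes the
  real axis.\<close>

lemma Im_f_pos:
  assumes "z \<notin> \<Omega>" "Im z > 0"
  shows "Im (f z) > 0"
proof -
  define t where "t = 1 / (z - of_real x\<^sub>0)"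
  have z: "z \<noteq> of_real x\<^sub>0" using assms x0 by auto
  then have t: "t \<noteq> 0" "1 / t + of_real x\<^sub>0 = z" by (auto simp: t_def)
  then have tV: "t \<in> V" using assms by (simp add: V_iff)
  have lt: "cmod (\<phi> t) < 1" using \<phi>_bij tV by (auto simp: bij_betw_def)
  have Imt: "Im t < 0" using assms z by (simp add: t_def Im_divide_1)
  have "\<not> Im (\<phi> t) > 0" using Im_\<psi>_pos[OF lt] \<psi>_\<phi>[OF tV] Imt by auto
  moreover have "Im (\<phi> t) \<noteq> 0"
  proof
    assume "Im (\<phi> t) = 0"
    then have "cnj (\<phi> t) = \<phi> t" by (simp add: complex_eq_iff)
    then have "cnj t = t" using \<phi>_cnj[OF tV] \<psi>_\<phi> tV cnj_in_V by metis
    then show False using Imt by (simp add: complex_eq_iff)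
  qed
  ultimately have "Im (\<phi> t) < 0" "\<phi> t \<noteq> 0" by auto
  moreover have "f z = 1 / \<phi> t" using t by (simp add: \<phi>_eq)
  ultimately show ?thesis by (simp add: Im_divide_1 divide_neg_pos)
qed

section \<open>The real axis and the difference quotient of \<open>f\<close> at
  \<open>a\<close>\<close>

context
  fixes a :: real
  assumes left: "\<And>x. of_real x \<in> \<Omega> \<Longrightarrow> a < x"
begin

abbreviation (input) fr :: "real \<Rightarrow> real" where "fr x \<equiv> Re (f (of_real x))"

lemma a_notin: "of_real a \<notin> \<Omega>"
  using left by blast

text \<open>Since \<open>fr x / x\<close> tends to \<open>c > 0\<close>, \<open>fr\<close> tends to
  minus infinity on the left; the intermediate value theorem applies because everything up to
  \<open>b\<close> lies outside \<Omega>.\<close>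

lemma fr_surj_below:
  assumes "b \<le> a" "y \<le> fr b"
  shows "\<exists>x\<le>b. fr x = y"
proof -
  have "filterlim (\<lambda>x::real. of_real x :: complex) at_infinity at_bot"
    by (intro filterlim_at_infinity_conv_norm_at_top[THEN iffD2]) (simp add: filterlim_abs_real at_bot_mirror filterlim_filtermap)
  then have "((\<lambda>x::real. f (of_real x) / of_real x) \<longlongrightarrow> of_real c) at_bot"
    by (rule filterlim_compose[OF lim])
  from tendsto_Re[OF this] have "((\<lambda>x. fr x / x) \<longlongrightarrow> c) at_bot" by (simp add: Re_divide_of_real)
  then have "\<forall>\<^sub>F x in at_bot. fr x / x > c / 2"
    using c_pos by (intro order_tendstoD) auto
  \<comment> \<open>A negative \<open>x\<close> turns the bound on the quotient into
    \<open>fr x < c / 2 * x\<close>, and \<open>x < 2 * y / c\<close> brings this below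
    \<open>y\<close>.\<close>
  moreover have "\<forall>\<^sub>F x in at_bot. x < min (min b 0) (2 * y / c)"
    unfolding eventually_at_bot_dense by blast
  ultimately have "\<forall>\<^sub>F x in at_bot. x \<le> b \<and> fr x \<le> y"
  proof eventually_elim
    case (elim x)
    then have "fr x < c / 2 * x" by (simp add: neg_less_divide_eq mult.commute)
    moreover have "c / 2 * x < y" using elim c_pos by (simp add: field_simps)
    ultimately show ?case using elim by auto
  qed
  then obtain x1 where x1: "x1 \<le> b" "fr x1 \<le> y"
    using eventually_happens'[OF trivial_limit_at_bot_linorder] by blast
  have "continuous_on {x1..b} (\<lambda>x. f (of_real x))"
    by (rule continuous_on_compose2[OF holomorphic_on_imp_continuous_on[OF holo]])
       (use left assms in \<open>force intro!: continuous_intros\<close>)+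
  then have "continuous_on {x1..b} fr" by (intro continuous_intros)
  from IVT'[OF x1(2) assms(2) x1(1) this] show ?thesis by auto
qed

text \<open>Otherwise the value \<open>fr y\<close> is also taken at some point up to
  \<open>x\<close>, against injectivity of \<open>f\<close>. The point \<open>y\<close> may lie on
  the other side of \<Omega>, where no continuity argument from \<open>x\<close> is
  possible.\<close>

lemma fr_less:
  assumes "x \<le> a" "x < y" "of_real y \<notin> \<Omega>"
  shows "fr x < fr y"
proof (rule ccontr)
  assume "\<not> fr x < fr y"
  then obtain x' where x': "x' \<le> x" "fr x' = fr y" using fr_surj_below[of x "fr y"] assms by auto
  have "of_real x' \<notin> \<Omega>" using left x' assms by force
  then have "f (of_real x') = f (of_real y)" using f_real x' assms(3) by metis
  then have "x' = y" using inj \<open>of_real x' \<notin> \<Omega>\<close> assms(3) by simp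
  with x' assms show False by simp
qed

definition diff_quot :: "complex \<Rightarrow> complex" where
  "diff_quot z = (if z = of_real a then deriv f (of_real a) else (f z - f (of_real a)) / (z - of_real a))"

lemma diff_quot_holo: "diff_quot holomorphic_on - \<Omega>"
  unfolding diff_quot_def using pole_lemma_open[OF holo] compact
  by (simp add: compact_imp_closed open_Compl)

lemma diff_quot_lim: "(diff_quot \<longlongrightarrow> of_real c) at_infinity"
proof -
  have 1: "((\<lambda>z. b / z) \<longlongrightarrow> 0) at_infinity" for b :: complex
    by (intro tendsto_divide_0[OF tendsto_const filterlim_ident])
  have "((\<lambda>z. (f z / z - f (of_real a) / z) / (1 - of_real a / z)) \<longlongrightarrow> (of_real c - 0) / (1 - 0)) at_infinity"
    by (intro tendsto_intros lim 1) auto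
  then have "((\<lambda>z. (f z / z - f (of_real a) / z) / (1 - of_real a / z)) \<longlongrightarrow> of_real c) at_infinity"
    by simp
  then show ?thesis
  proof (rule Lim_transform_eventually)
    show "\<forall>\<^sub>F z in at_infinity. (f z / z - f (of_real a) / z) / (1 - of_real a / z) = diff_quot z"
      using eventually_not_equal_at_infinity[of 0] eventually_not_equal_at_infinity[of "of_real a"]
    proof eventually_elim
      case (elim z)
      have "(f z / z - f (of_real a) / z) / (1 - of_real a / z)
          = ((f z - f (of_real a)) / z) / ((z - of_real a) / z)"
        using elim by (simp add: diff_divide_distrib)
      then show ?case using elim by (simp add: diff_quot_def)
    qed
  qed
qed

text \<open>If the quotient is a real \<open>r \<le> 0\<close>, then
  \<open>Im (f z) = r * Im z\<close>, because \<open>a\<close> and \<open>f a\<close> are real. But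
  \<open>f\<close> preserves the upper and the lower half plane.\<close>

lemma diff_quot_nonreal:
  assumes "z \<notin> \<Omega>" "Im z \<noteq> 0"
  shows "diff_quot z \<notin> \<real>\<^sub>\<le>\<^sub>0"
proof
  assume "diff_quot z \<in> \<real>\<^sub>\<le>\<^sub>0"
  then obtain r where r: "r \<le> 0" "diff_quot z = of_real r" by (auto elim: nonpos_Reals_cases)
  have za: "z \<noteq> of_real a" using assms by auto
  then have "f z - f (of_real a) = of_real r * (z - of_real a)"
    using r by (simp add: diff_quot_def field_simps)
  moreover have "Im (f (of_real a)) = 0" using f_real[OF a_notin] by (metis Im_complex_of_real)
  ultimately have "Im (f z) = Im (of_real r * (z - of_real a))" by (metis diff_zero minus_complex.sel(2))
  then have eq: "Im (f z) = r * Im z" by simp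
  show False
  proof (cases "Im z > 0")
    case True
    then have "Im (f z) > 0" using assms Im_f_pos by auto
    moreover have "r * Im z \<le> 0" using r True by (simp add: mult_nonpos_nonneg)
    ultimately show False using eq by simp
  next
    case False
    then have "Im (f (cnj z)) > 0" using assms by (intro Im_f_pos) (auto simp: cnj_in_iff)
    then have "Im (f z) < 0" using f_cnj[OF assms(1)] by simp
    moreover have "r * Im z \<ge> 0" using r False by (simp add: mult_nonpos_nonpos)
    ultimately show False using eq by simp
  qed
qed

lemma diff_quot_real:
  assumes "of_real x \<notin> \<Omega>" "x \<noteq> a"
  shows "diff_quot (of_real x) = of_real ((fr x - fr a) / (x - a))" "(fr x - fr a) / (x - a) > 0"
proof -
  show "diff_quot (of_real x) = of_real ((fr x - fr a) / (x - a))"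
    using assms f_real[OF assms(1)] f_real[OF a_notin]
    by (simp add: diff_quot_def)
  show "(fr x - fr a) / (x - a) > 0"
  proof (cases "x < a")
    case True
    then show ?thesis using fr_less[of x a] a_notin by (intro divide_neg_neg) auto
  next
    case False
    then show ?thesis using fr_less[of a x] assms by (intro divide_pos_pos) auto
  qed
qed

text \<open>The value at \<open>a\<close> is a limit of positive quotients from the left, hence real
  and nonnegative; it is nonzero because an injective holomorphic map has nonvanishing
  derivative.\<close>

lemma diff_quot_at: "diff_quot (of_real a) \<notin> \<real>\<^sub>\<le>\<^sub>0"
proof -
  have op: "open (- \<Omega>)" using compact by (simp add: compact_imp_closed open_Compl)
  then have "isCont diff_quot (of_real a)"
    using holomorphic_on_imp_continuous_on[OF diff_quot_holo] a_notin
    by (simp add: continuous_on_eq_continuous_at)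
  moreover have "filterlim (\<lambda>x. of_real x :: complex) (at (of_real a)) (at_left a)"
    unfolding filterlim_at
    by (intro conjI tendsto_intros) (auto simp: eventually_at_filter intro!: tendsto_intros)
  ultimately have "((\<lambda>x. diff_quot (of_real x)) \<longlongrightarrow> diff_quot (of_real a)) (at_left a)"
    unfolding isCont_def by (rule filterlim_compose)
  moreover have "\<forall>\<^sub>F x in at_left a. diff_quot (of_real x) \<in> \<real>\<^sub>\<ge>\<^sub>0"
    using eventually_at_left_real[of "a - 1" a]
  proof (rule eventually_mono)
    fix x assume "x \<in> {a - 1<..<a}"
    then have "of_real x \<notin> \<Omega>" "x \<noteq> a" using left[of x] by auto
    from diff_quot_real[OF this] show "diff_quot (of_real x) \<in> \<real>\<^sub>\<ge>\<^sub>0"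
      by (metis less_imp_le nonneg_Reals_of_real_iff)
  qed simp
  ultimately have "diff_quot (of_real a) \<in> \<real>\<^sub>\<ge>\<^sub>0"
    by (intro Lim_in_closed_set[OF closed_nonneg_Reals_complex]) auto
  moreover have "diff_quot (of_real a) \<noteq> 0"
    using holomorphic_injective_imp_regular[OF holo op] bij a_notin
    by (auto simp: diff_quot_def bij_betw_def)
  ultimately show ?thesis
    by (auto simp: complex_nonneg_Reals_iff complex_nonpos_Reals_iff complex_eq_iff)
qed

lemma diff_quot_notin_nonpos:
  assumes "z \<notin> \<Omega>"
  shows "diff_quot z \<notin> \<real>\<^sub>\<le>\<^sub>0"
proof (cases "Im z = 0")
  case False
  then show ?thesis using assms diff_quot_nonreal by blast
next
  case True
  then have z: "z = of_real (Re z)" by (simp add: complex_eq_iff)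
  show ?thesis
  proof (cases "Re z = a")
    case True
    then show ?thesis using z diff_quot_at by metis
  next
    case False
    then show ?thesis using diff_quot_real[of "Re z"] assms z
      by (metis nonpos_Reals_of_real_iff not_le)
  qed
qed

end

end

section \<open>Polynomial preimages\<close>

lemma powr_inverse_power:
  fixes x :: complex
  assumes "n > 0"
  shows "(x powr (1 / of_nat n)) ^ n = x"
proof (cases "x = 0")
  case False
  then have "(x powr (1 / of_nat n)) ^ n = x powr (of_nat n * (1 / of_nat n))"
    by (simp add: powr_def exp_of_nat_mult[symmetric])
  then show ?thesis using assms False by simp
qed (use assms in simp)

lemma root_of_unity_quotient:
  fixes x y :: complex
  assumes "x ^ n = y ^ n" "n > 0"
  obtains \<omega> where "\<omega> ^ n = 1" "x = \<omega> * y"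
proof (cases "y = 0")
  case True
  with assms show ?thesis using that[of 1] by (simp add: power_0_left)
next
  case False
  with assms show ?thesis using that[of "x / y"] by (simp add: power_divide)
qed

context symmetric_exterior_map
begin

context
  fixes \<alpha> a :: real and n :: nat
  assumes left: "\<And>x. of_real x \<in> \<Omega> \<Longrightarrow> a < x" and \<alpha>: "\<alpha> > 0" and n: "n \<ge> 2"
begin

definition pol :: "complex \<Rightarrow> complex" where "pol z = of_real \<alpha> * z ^ n + of_real a"

text \<open>Since \<open>pol z - a = \<alpha> * z ^ n\<close>, the base of the root in the formula
  for \<Phi> is \<open>diff_quot a (pol z) / c\<close> for \<open>z \<noteq> 0\<close>. In this form
  the extension to 0 is built in.\<close>

definition lemn :: "complex \<Rightarrow> complex" where
  "lemn z = z * (diff_quot a (pol z) / of_real c) powr (1 / of_nat n)"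

lemma diff_quot_pol:
  assumes "z \<noteq> 0"
  shows "diff_quot a (pol z) = (f (pol z) - f (of_real a)) / (of_real \<alpha> * z ^ n)"
  using assms \<alpha> n by (simp add: diff_quot_def[OF left] pol_def)

lemma lemn_power: "lemn z ^ n = (f (pol z) - f (of_real a)) / of_real (\<alpha> * c)"
proof -
  have "lemn z ^ n = z ^ n * (diff_quot a (pol z) / of_real c)"
    using n by (simp add: lemn_def power_mult_distrib powr_inverse_power)
  also have "\<dots> = (f (pol z) - f (of_real a)) / of_real (\<alpha> * c)"
  proof (cases "z = 0")
    case True
    then show ?thesis using n by (simp add: pol_def power_0_left)
  qed (use \<alpha> c_pos in \<open>simp add: diff_quot_pol field_simps\<close>)
  finally show ?thesis .
qed

lemma lemn_rotate: "\<omega> ^ n = 1 \<Longrightarrow> lemn (\<omega> * z) = \<omega> * lemn z"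
  by (simp add: lemn_def pol_def power_mult_distrib)

lemma diff_quot_normalized_notin_nonpos: "\<zeta> \<notin> \<Omega> \<Longrightarrow> diff_quot a \<zeta> / of_real c \<notin> \<real>\<^sub>\<le>\<^sub>0"
  using diff_quot_notin_nonpos[OF left] c_pos
  by (auto simp: complex_nonpos_Reals_iff Re_divide_of_real Im_divide_of_real divide_le_0_iff)

lemma pol_eq_imp_power_eq: "pol z = pol w \<Longrightarrow> z ^ n = w ^ n"
  using \<alpha> by (simp add: pol_def)

text \<open>Taking \<open>n\<close>th powers shows that \<open>f\<close> agrees at
  \<open>pol z\<close> and \<open>pol w\<close>, so these are equal. Then both root factors
  coincide, and being nonzero they cancel.\<close>

lemma lemn_inj: "inj_on lemn (- (pol -` \<Omega>))"
proof (rule inj_onI)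
  fix z w assume zw: "z \<in> - (pol -` \<Omega>)" "w \<in> - (pol -` \<Omega>)" "lemn z = lemn w"
  then have "f (pol z) = f (pol w)"
    using lemn_power[of z] lemn_power[of w] \<alpha> c_pos by (simp add: field_simps)
  then have eq: "pol z = pol w" using inj zw by simp
  have "diff_quot a (pol w) / of_real c \<noteq> 0" using diff_quot_normalized_notin_nonpos[of "pol w"] zw by auto
  with zw(3) show "z = w" by (simp add: lemn_def eq)
qed

text \<open>For surjectivity, choose \<zeta> outside \<Omega> matching \<open>w\<close> and any
  \<open>z\<close> with \<open>pol z = \<zeta>\<close>. Then \<open>lemn z\<close> and
  \<open>w\<close> have the same \<open>n\<close>th power, and rotating \<open>z\<close> by their
  quotient, a root of unity, corrects the difference.\<close>

lemma lemn_image: "lemn ` (- (pol -` \<Omega>)) = {w. 1 < cmod (of_real (\<alpha> * c) * w ^ n + f (of_real a))}"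
proof (intro equalityI subsetI)
  fix w assume "w \<in> lemn ` (- (pol -` \<Omega>))"
  then obtain z where z: "pol z \<notin> \<Omega>" "w = lemn z" by auto
  then have "of_real (\<alpha> * c) * w ^ n + f (of_real a) = f (pol z)"
    using lemn_power[of z] \<alpha> c_pos by simp
  with norm_gt_1[OF z(1)] show "w \<in> {w. 1 < cmod (of_real (\<alpha> * c) * w ^ n + f (of_real a))}"
    by simp
next
  fix w assume "w \<in> {w. 1 < cmod (of_real (\<alpha> * c) * w ^ n + f (of_real a))}"
  then obtain \<zeta> where \<zeta>: "\<zeta> \<notin> \<Omega>" "of_real (\<alpha> * c) * w ^ n + f (of_real a) = f \<zeta>"
    using bij by (force simp: bij_betw_def)
  define z where "z = ((\<zeta> - of_real a) / of_real \<alpha>) powr (1 / of_nat n)"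
  have "pol z = \<zeta>" using n \<alpha> by (simp add: pol_def z_def powr_inverse_power)
  then have "lemn z ^ n = (f \<zeta> - f (of_real a)) / of_real (\<alpha> * c)" by (simp add: lemn_power)
  also have "\<dots> = w ^ n" unfolding \<zeta>(2)[symmetric] using \<alpha> c_pos by simp
  finally obtain \<omega> where \<omega>: "\<omega> ^ n = 1" "w = \<omega> * lemn z"
    using root_of_unity_quotient[of w n "lemn z"] n by auto
  have "pol (\<omega> * z) = \<zeta>" using \<omega> \<open>pol z = \<zeta>\<close> by (simp add: pol_def power_mult_distrib)
  then show "w \<in> lemn ` (- (pol -` \<Omega>))" using \<omega> \<zeta> lemn_rotate by (intro image_eqI[of _ _ "\<omega> * z"]) auto
qed

section \<open>Behaviour of the map at infinity\<close>

lemma continuous_pol: "continuous_on A pol"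
  unfolding pol_def by (intro continuous_intros)

lemma norm_pol_ge: "\<forall>\<^sub>F z in at_infinity. \<alpha> / 2 * (cmod z)\<^sup>2 \<le> cmod (pol z)"
  unfolding eventually_at_infinity
proof (intro exI allI impI)
  \<comment> \<open>Beyond 1 the powers of \<open>cmod z\<close> increase with the exponent; beyond
    the second bound, half of the leading term absorbs \<open>\<bar>a\<bar>\<close>.\<close>
  fix z assume z: "max 1 (2 * \<bar>a\<bar> / \<alpha>) \<le> cmod z"
  have 1: "(cmod z)\<^sup>2 \<le> cmod z ^ n" using z n by (intro power_increasing) auto
  have "cmod z \<le> (cmod z)\<^sup>2" using z by (intro self_le_power) auto
  then have "\<alpha> / 2 * cmod z \<le> \<alpha> / 2 * cmod z ^ n" using 1 \<alpha> by (intro mult_left_mono) auto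
  moreover have "\<bar>a\<bar> \<le> \<alpha> / 2 * cmod z" using z \<alpha> by (simp add: field_simps)
  moreover have "\<alpha> * cmod z ^ n - \<bar>a\<bar> \<le> cmod (pol z)"
    using norm_triangle_ineq2[of "of_real \<alpha> * z ^ n" "- of_real a"] \<alpha>
    by (simp add: pol_def norm_mult norm_power)
  moreover have "\<alpha> / 2 * (cmod z)\<^sup>2 \<le> \<alpha> / 2 * cmod z ^ n" using 1 \<alpha> by (intro mult_left_mono) auto
  ultimately show "\<alpha> / 2 * (cmod z)\<^sup>2 \<le> cmod (pol z)" by (simp add: field_simps)
qed

lemma filterlim_pol: "filterlim pol at_infinity at_infinity"
  unfolding pol_def using \<alpha> n
  by (intro tendsto_add_filterlim_at_infinity'[OF _ tendsto_const]
      tendsto_mult_filterlim_at_infinity[OF tendsto_const] filterlim_power_at_infinity filterlim_ident) auto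

lemma compact_preimage: "compact (pol -` \<Omega>)"
proof -
  have "closed (pol -` \<Omega>)"
    using compact continuous_pol by (intro closed_vimage) (auto simp: compact_imp_closed)
  moreover have "bounded (pol -` \<Omega>)"
  proof -
    obtain r where r: "r > 0" "\<Omega> \<subseteq> ball 0 r"
      using compact by (metis bounded_subset_ballD compact_imp_bounded)
    have "\<forall>\<^sub>F z in at_infinity. r \<le> cmod (pol z)"
      using filterlim_pol r unfolding filterlim_at_infinity[OF order_refl] by simp
    then obtain b where b: "\<And>z. b \<le> cmod z \<Longrightarrow> r \<le> cmod (pol z)"
      unfolding eventually_at_infinity by auto
    show ?thesis
    proof (rule boundedI)
      fix z assume "z \<in> pol -` \<Omega>"
      then have "\<not> r \<le> cmod (pol z)" using r by auto
      then show "cmod z \<le> b" using b[of z] by linarith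
    qed
  qed
  ultimately show ?thesis by (simp add: compact_eq_bounded_closed)
qed

definition q :: "complex \<Rightarrow> complex" where
  "q \<zeta> = (diff_quot a \<zeta> / of_real c) powr (1 / of_nat n)"

lemma q_holo: "q holomorphic_on - \<Omega>"
  unfolding q_def using diff_quot_normalized_notin_nonpos c_pos
  by (intro holomorphic_intros diff_quot_holo[OF left]) auto

lemma q_lim: "(q \<longlongrightarrow> 1) at_infinity"
proof -
  have "((\<lambda>\<zeta>. diff_quot a \<zeta> / of_real c) \<longlongrightarrow> of_real c / of_real c) at_infinity"
    using c_pos by (intro tendsto_intros diff_quot_lim[OF left]) auto
  then have "((\<lambda>\<zeta>. diff_quot a \<zeta> / of_real c) \<longlongrightarrow> 1) at_infinity" using c_pos by simp
  then have "(q \<longlongrightarrow> 1 powr (1 / of_nat n)) at_infinity"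
    unfolding q_def by (intro tendsto_powr_complex tendsto_const) auto
  then show ?thesis by simp
qed

lemma lemn_eq: "lemn z = z * q (pol z)"
  by (simp add: lemn_def q_def)

lemma lemn_holo: "lemn holomorphic_on - (pol -` \<Omega>)"
proof -
  have "(\<lambda>z. q (pol z)) holomorphic_on - (pol -` \<Omega>)"
    by (rule holomorphic_on_compose_gen[of pol _ q "- \<Omega>", unfolded o_def, OF _ q_holo])
       (auto simp: pol_def[abs_def] intro!: holomorphic_intros)
  then show ?thesis unfolding lemn_eq[abs_def] by (intro holomorphic_intros)
qed

lemma lemn_lim: "((\<lambda>z. lemn z / z) \<longlongrightarrow> 1) at_infinity"
proof -
  have "((\<lambda>z. q (pol z)) \<longlongrightarrow> 1) at_infinity" by (rule filterlim_compose[OF q_lim filterlim_pol])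
  then show ?thesis
    by (rule filterlim_mono_eventually[OF _ order_refl order_refl])
       (use eventually_not_equal_at_infinity[of "0::complex"] in \<open>rule eventually_mono, simp add: lemn_eq\<close>)
qed

text \<open>Since \<open>q\<close> is holomorphic at infinity with value \<open>1\<close>, \<open>q(\<zeta>) - 1 = O(1 / \<zeta>)\<close>; and
  \<open>z \<cdot> O(1 / pol(z)) = O(1 / z)\<close> because \<open>n \<ge> 2\<close>.\<close>

lemma lemn_bigo: "(\<lambda>z. lemn z - z) \<in> O[at_infinity](\<lambda>z. 1 / z)"
proof -
  let ?Q = "\<lambda>t. if t = 0 then 1 else q (1 / t)"
  have "?Q holomorphic_on inversion_nhd \<Omega>"
    by (rule holomorphic_on_inversion_nhd[OF compact q_holo q_lim])
  then have "?Q field_differentiable at 0"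
    using open_inversion_nhd[OF compact] by (auto intro: holomorphic_on_imp_differentiable_at simp: inversion_nhd_def)
  then obtain d where "(?Q has_field_derivative d) (at 0)" by (auto simp: field_differentiable_def)
  then have "((\<lambda>t. (?Q t - 1) / t) \<longlongrightarrow> d) (at 0)" by (simp add: DERIV_def cong: if_cong)
  then have "((\<lambda>t. (q (1 / t) - 1) / t) \<longlongrightarrow> d) (at 0)"
    by (rule Lim_transform_eventually) (simp add: eventually_at_filter)
  then have "((\<lambda>\<zeta>. (q \<zeta> - 1) * \<zeta>) \<longlongrightarrow> d) at_infinity"
    using lim_at_infinity_0[of "\<lambda>\<zeta>. (q \<zeta> - 1) * \<zeta>" d]
    by (simp add: o_def inverse_eq_divide mult.commute[of _ "1 / _"] del: mult_1)
  then have "((\<lambda>z. (q (pol z) - 1) * pol z) \<longlongrightarrow> d) at_infinity"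
    by (rule filterlim_compose[OF _ filterlim_pol])
  then have "\<forall>\<^sub>F z in at_infinity. cmod ((q (pol z) - 1) * pol z) < cmod d + 1"
    by (intro order_tendstoD(2)[OF tendsto_norm]) auto
  moreover have "\<forall>\<^sub>F z in at_infinity. z \<noteq> (0 :: complex)"
    by (rule eventually_not_equal_at_infinity)
  ultimately have "\<forall>\<^sub>F z in at_infinity. cmod (lemn z - z) \<le> (cmod d + 1) / (\<alpha> / 2) * cmod (1 / z)"
    using norm_pol_ge
  proof eventually_elim
    case (elim z)
    have pos: "\<alpha> / 2 * (cmod z)\<^sup>2 > 0" using elim \<alpha> by simp
    have "cmod (q (pol z) - 1) * (\<alpha> / 2 * (cmod z)\<^sup>2) \<le> cmod (q (pol z) - 1) * cmod (pol z)"
      using elim by (intro mult_left_mono) auto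
    also have "\<dots> \<le> cmod d + 1" using elim by (simp add: norm_mult)
    finally have "cmod (q (pol z) - 1) \<le> (cmod d + 1) / (\<alpha> / 2 * (cmod z)\<^sup>2)"
      using pos by (simp add: pos_le_divide_eq)
    then have "cmod z * cmod (q (pol z) - 1) \<le> cmod z * ((cmod d + 1) / (\<alpha> / 2 * (cmod z)\<^sup>2))"
      by (intro mult_left_mono) auto
    moreover have "lemn z - z = z * (q (pol z) - 1)" by (simp add: lemn_eq algebra_simps)
    ultimately show ?case
      using elim \<alpha> by (simp add: norm_mult norm_divide power2_eq_square)
  qed
  then show ?thesis by (rule bigoI)
qed

section \<open>Branches of the inverse and the components of the preimage\<close>

definition branch :: "nat \<Rightarrow> complex \<Rightarrow> complex" where
  "branch j \<zeta> = cis (2 * pi * real j / real n) * ((\<zeta> - of_real a) / of_real \<alpha>) powr (1 / of_nat n)"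

lemma branch_root_of_unity: "cis (2 * pi * real j / real n) ^ n = 1"
proof -
  have "real n * (2 * pi * real j / real n) = 2 * pi * real j" using n by simp
  then show ?thesis unfolding Complex.DeMoivre by (metis cis_multiple_2pi Ints_of_nat)
qed

lemma pol_branch: "pol (branch j \<zeta>) = \<zeta>"
  using n \<alpha> branch_root_of_unity[of j] by (simp add: pol_def branch_def power_mult_distrib powr_inverse_power)

text \<open>The principal root is discontinuous only on the nonpositive axis; its argument lies
  there only for a real \<zeta> with \<open>\<zeta> \<le> a\<close>, which \<Omega> does not
  contain.\<close>

lemma continuous_branch: "continuous_on \<Omega> (branch j)"
proof -
  have "(\<zeta> - of_real a) / of_real \<alpha> \<notin> \<real>\<^sub>\<le>\<^sub>0" if "\<zeta> \<in> \<Omega>" for \<zeta>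
  proof
    assume "(\<zeta> - of_real a) / of_real \<alpha> \<in> \<real>\<^sub>\<le>\<^sub>0"
    then obtain r where r: "r \<le> 0" "(\<zeta> - of_real a) / of_real \<alpha> = of_real r"
      by (auto elim: nonpos_Reals_cases)
    then have \<zeta>: "\<zeta> = of_real (a + \<alpha> * r)" using \<alpha> by (simp add: field_simps)
    then have "a < a + \<alpha> * r" using left that by blast
    then show False using r \<alpha> by (simp add: zero_less_mult_iff)
  qed
  then show ?thesis unfolding branch_def using \<alpha> n
    by (intro continuous_intros) (auto simp: complex_nonpos_Reals_iff)
qed

lemma inj_branch: "inj_on (branch j) \<Omega>"
  by (metis pol_branch inj_on_def)

text \<open>Applying \<open>pol\<close> to a common value shows that both arguments equal the same
  \<zeta>. As \<open>\<zeta> \<noteq> a\<close>, the root is nonzero and cancels, leaving two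
  distinct roots of unity equal.\<close>

lemma branch_disjoint: "disjoint_family_on (\<lambda>j. branch j ` \<Omega>) {..<n}"
  unfolding disjoint_family_on_def
proof (intro ballI impI)
  fix j k assume jk: "j \<in> {..<n}" "k \<in> {..<n}" "j \<noteq> k"
  show "branch j ` \<Omega> \<inter> branch k ` \<Omega> = {}"
  proof (rule ccontr)
    assume "branch j ` \<Omega> \<inter> branch k ` \<Omega> \<noteq> {}"
    then obtain \<zeta> \<xi> where *: "\<zeta> \<in> \<Omega>" "\<xi> \<in> \<Omega>" "branch j \<zeta> = branch k \<xi>" by auto
    then have "\<zeta> = \<xi>" using pol_branch by metis
    moreover have "\<zeta> \<noteq> of_real a" using * left by blast
    ultimately have "cis (2 * pi * real j / real n) = cis (2 * pi * real k / real n)"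
      using * \<alpha> by (simp add: branch_def)
    then show False
      using Complex.bij_betw_roots_unity[of n] n jk by (auto simp: bij_betw_def inj_on_def)
  qed
qed

text \<open>A point \<open>z\<close> and \<open>branch 0 (pol z)\<close> have the same
  \<open>n\<close>th power, so they differ by one of the \<open>n\<close> rotations.\<close>

lemma preimage_eq: "pol -` \<Omega> = (\<Union>j<n. branch j ` \<Omega>)"
proof (intro equalityI subsetI)
  fix z assume z: "z \<in> pol -` \<Omega>"
  have "z ^ n = branch 0 (pol z) ^ n" using pol_eq_imp_power_eq pol_branch by metis
  then obtain \<omega> where \<omega>: "\<omega> ^ n = 1" "z = \<omega> * branch 0 (pol z)"
    using root_of_unity_quotient n by (metis less_le_trans pos2)
  then obtain j where "j < n" "\<omega> = cis (2 * pi * real j / real n)"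
    using Complex.bij_betw_roots_unity[of n] n by (force simp: bij_betw_def)
  then have "j < n" "z = branch j (pol z)" using \<omega>(2) by (auto simp: branch_def)
  then show "z \<in> (\<Union>j<n. branch j ` \<Omega>)" using z by (intro UN_I[of j] image_eqI) auto
qed (auto simp: pol_branch)

lemma preimage_components:
  assumes "simply_connected_compactum \<Omega>" "\<nexists>z. \<Omega> = {z}"
  shows "simply_connected_compactum (branch j ` \<Omega>)" "\<nexists>z. branch j ` \<Omega> = {z}"
    and "connected (- (pol -` \<Omega>))"
proof -
  show *: "simply_connected_compactum (branch j ` \<Omega>)" for j
    using assms continuous_branch inj_branch by (intro simply_connected_compactum_inj_image)
  show "\<nexists>z. branch j ` \<Omega> = {z}"
  proof
    assume "\<exists>z. branch j ` \<Omega> = {z}"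
    then obtain z where "branch j ` \<Omega> = {z}" by auto
    then have "pol ` branch j ` \<Omega> = {pol z}" by simp
    then show False using assms by (simp add: image_image pol_branch)
  qed
  show "connected (- (pol -` \<Omega>))"
    unfolding preimage_eq using * connectedin_sphere_Compl_iff
    by (intro connected_Compl_UN_disjoint branch_disjoint)
       (auto simp: simply_connected_compactum_def)
qed

section \<open>The lemniscatic map of the preimage\<close>

text \<open>The two descriptions of \<open>L\<close> play different roles: as an image of the
  connected complement of the preimage it is connected, and as a superlevel set of a binomial it has
  lemniscatic form.\<close>

lemma lemniscatic_map_polynomial_preimage:
  assumes \<Omega>: "simply_connected_compactum \<Omega>" "\<nexists>z. \<Omega> = {z}"
    and L: "L = insert None (Some ` lemn ` (- (pol -` \<Omega>)))"
    and L': "L = sphere_superlevel (\<lambda>w. root n (cmod (w ^ n + b))) \<mu>" and b: "b \<noteq> 0" and \<mu>: "\<mu> > 0"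
  shows "lemniscatic_domain n L" "lemniscatic_map (pol -` \<Omega>) L (map_option lemn)"
proof -
  have "connectedin riemann_sphere (- Some ` (pol -` \<Omega>))"
    using connectedin_sphere_Compl_iff compact_preimage preimage_components[OF \<Omega>] by blast
  moreover have "continuous_map (subtopology riemann_sphere (- Some ` (pol -` \<Omega>))) riemann_sphere (map_option lemn)"
    by (rule continuous_map_sphere_extend[OF compact_preimage holomorphic_on_imp_continuous_on[OF lemn_holo]
          filterlim_at_infinity_of_quotient[OF lemn_lim]]) simp
  ultimately have "connectedin riemann_sphere (map_option lemn ` (- Some ` (pol -` \<Omega>)))"
    by (intro connectedin_continuous_map_image[of "subtopology riemann_sphere (- Some ` (pol -` \<Omega>))"])
      (auto simp: connectedin_subtopology)
  then have con: "connectedin riemann_sphere L" unfolding L sphere_Compl_eq by (simp add: image_image)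
  note ld = lemniscatic_domain_binomial[OF _ b \<mu> L' con]
  show dom: "lemniscatic_domain n L" using ld n by simp
  have op: "openin riemann_sphere L" using ld n by simp
  have "bijective_conformal (- Some ` (pol -` \<Omega>)) L (map_option lemn)"
    by (rule bijective_conformal_extend[OF compact_preimage lemn_holo lemn_inj lemn_lim _ op L]) simp
  moreover have "\<exists>N F. disjoint_family_on F {..<N} \<and> pol -` \<Omega> = (\<Union>j<N. F j) \<and>
     (\<forall>j<N. simply_connected_compactum (F j) \<and> (\<nexists>z. F j = {z})) \<and> lemniscatic_domain N L"
    using preimage_components[OF \<Omega>] branch_disjoint preimage_eq dom
    by (intro exI[of _ n] exI[of _ "\<lambda>j. branch j ` \<Omega>"]) auto
  ultimately show "lemniscatic_map (pol -` \<Omega>) L (map_option lemn)"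
    using lemn_bigo by (simp add: lemniscatic_map_def)
qed

end

end

theorem theorem3p1:
  fixes \<Omega> :: "complex set"
    and \<Phi>' :: "complex option \<Rightarrow> complex option"
    and c \<alpha> \<alpha>\<^sub>0 :: real
    and n :: nat
  assumes "simply_connected_compactum \<Omega>"
    and "\<nexists>z. \<Omega> = {z}"
    and "cnj ` \<Omega> = \<Omega>"
    and "exterior_riemann_map \<Omega> \<Phi>'"
    and "has_deriv_at_infinity \<Phi>' (of_real c)"
    and "n \<ge> 2"
    and "\<alpha> > 0"
    and "\<And>x :: real. of_real x \<in> \<Omega> \<Longrightarrow> \<alpha>\<^sub>0 < x"
  defines "P \<equiv> \<lambda>z :: complex. of_real \<alpha> * z ^ n + of_real \<alpha>\<^sub>0"
  defines "E \<equiv> P -` \<Omega>"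
  defines "G \<equiv> \<lambda>z. the (\<Phi>' (Some (P z)))"
  defines "\<mu> \<equiv> root n (1 / (\<alpha> * c))"
  defines "absU \<equiv> \<lambda>w. root n (cmod (w ^ n + of_real \<mu> ^ n * G 0))"
  defines "L \<equiv> sphere_superlevel absU \<mu>"
  defines "\<Phi> \<equiv> \<lambda>p. case p of
      None \<Rightarrow> None
    | Some z \<Rightarrow> Some (if z = 0 then 0
        else z * (of_real \<mu> ^ n / z ^ n * (G z - G 0)) powr (1 / of_nat n))"
  shows "(\<exists>F :: nat \<Rightarrow> complex set.
            disjoint_family_on F {..<n} \<and> (\<forall>j<n. simply_connected_compactum (F j)) \<and>
            E = (\<Union>j<n. F j)) \<and>
         \<mu> > 0 \<and>
         lemniscatic_domain n L \<and>
         lemniscatic_map E L \<Phi>"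
proof -
  define f where "f = (\<lambda>z. the (\<Phi>' (Some z)))"
  have \<Omega>: "compact \<Omega>" "\<Omega> \<noteq> {}" "connected \<Omega>"
    using assms(1) by (auto simp: simply_connected_compactum_def)
  obtain x\<^sub>0 :: real where x0: "of_real x\<^sub>0 \<in> \<Omega>"
    using symmetric_connected_real_point assms(3) \<Omega> by blast
  have "bijective_conformal (- Some ` \<Omega>) (insert None (Some ` {w. 1 < cmod w})) \<Phi>'" "\<Phi>' None = None"
    using assms(4) by (auto simp: exterior_riemann_map_def sphere_superlevel_def)
  note f = bijective_conformal_finite_bij[OF this \<Omega>(1), folded f_def]
    bijective_conformal_finite_holomorphic[OF this \<Omega>(1), folded f_def]
  have lim: "((\<lambda>z. f z / z) \<longlongrightarrow> of_real c) at_infinity"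
    unfolding f_def by (rule has_deriv_at_infinity_tendsto) fact
  \<comment> \<open>Positivity of \<open>c\<close> is not assumed directly: it comes from the
    normalization, whose constant equals \<open>c\<close> by uniqueness of limits.\<close>
  obtain c' :: real where "c' > 0" "has_deriv_at_infinity \<Phi>' (of_real c')"
    using assms(4) by (auto simp: exterior_riemann_map_def)
  then have "((\<lambda>z. f z / z) \<longlongrightarrow> of_real c') at_infinity"
    unfolding f_def by (intro has_deriv_at_infinity_tendsto)
  then have "complex_of_real c = of_real c'"
    using lim tendsto_unique trivial_limit_at_infinity by blast
  with \<open>c' > 0\<close> have c: "c > 0" by simp
  interpret symmetric_exterior_map \<Omega> f c x\<^sub>0
    using \<Omega>(1) assms(3) x0 f c lim by unfold_locales auto
  have n: "n > 0" using assms(6) by simp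
  have \<mu>: "\<mu> > 0" "\<mu> ^ n = 1 / (\<alpha> * c)" using n assms(7) c by (simp_all add: \<mu>_def)
  have \<mu>n: "complex_of_real \<mu> ^ n = 1 / of_real (\<alpha> * c)"
    using \<mu>(2) by (metis of_real_power of_real_divide of_real_1)
  note ctx = assms(8,7,6)
  have P: "pol \<alpha> \<alpha>\<^sub>0 n = P"
    by (simp add: fun_eq_iff P_def pol_def[OF ctx])
  have E: "pol \<alpha> \<alpha>\<^sub>0 n -` \<Omega> = E" by (simp add: P E_def)
  have G: "G z = f (P z)" for z by (simp add: G_def f_def)
  have P0: "P 0 = of_real \<alpha>\<^sub>0" using n by (simp add: P_def power_0_left)
  have \<Phi>: "\<Phi> = map_option (lemn \<alpha> \<alpha>\<^sub>0 n)"
  proof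
    fix p show "\<Phi> p = map_option (lemn \<alpha> \<alpha>\<^sub>0 n) p"
    proof (cases p)
      case (Some z)
      have "of_real \<mu> ^ n / z ^ n * (G z - G 0) = diff_quot \<alpha>\<^sub>0 (P z) / of_real c" if "z \<noteq> 0"
        using diff_quot_pol[OF ctx that] assms(7) c unfolding \<mu>n G P0 P
        by (simp add: field_simps)
      then show ?thesis by (simp add: Some \<Phi>_def lemn_def[OF ctx] P)
    qed (simp add: \<Phi>_def)
  qed
  define b where "b = of_real \<mu> ^ n * G 0"
  have "of_real \<alpha>\<^sub>0 \<notin> \<Omega>" using assms(8) by blast
  then have "cmod (f (of_real \<alpha>\<^sub>0)) > 1" by (rule norm_gt_1)
  then have b: "b \<noteq> 0" using \<mu> by (auto simp: b_def G P0)
  \<comment> \<open>Multiplication by \<open>\<alpha> * c\<close>, the reciprocal of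
    \<open>\<mu> ^ n\<close>, turns the lemniscate inequality into the one that describes the image
    of \<open>lemn\<close>.\<close>
  have "\<mu> < absU w \<longleftrightarrow> 1 < cmod (of_real (\<alpha> * c) * w ^ n + f (of_real \<alpha>\<^sub>0))" for w
  proof -
    have "\<mu> < absU w \<longleftrightarrow> 1 / (\<alpha> * c) < cmod (w ^ n + of_real \<mu> ^ n * G 0)"
      using n by (simp add: \<mu>_def absU_def)
    also have "\<dots> \<longleftrightarrow> 1 < \<alpha> * c * cmod (w ^ n + of_real \<mu> ^ n * G 0)"
      using assms(7) c by (simp add: field_simps)
    also have "\<alpha> * c * cmod (w ^ n + of_real \<mu> ^ n * G 0)
        = cmod (of_real (\<alpha> * c) * (w ^ n + of_real \<mu> ^ n * G 0))"
      using assms(7) c by (simp add: norm_mult)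
    also have "of_real (\<alpha> * c) * (w ^ n + of_real \<mu> ^ n * G 0)
        = of_real (\<alpha> * c) * w ^ n + f (of_real \<alpha>\<^sub>0)"
      unfolding \<mu>n G P0 using assms(7) c by (simp add: distrib_left)
    finally show ?thesis .
  qed
  then have L: "L = insert None (Some ` lemn \<alpha> \<alpha>\<^sub>0 n ` (- (pol \<alpha> \<alpha>\<^sub>0 n -` \<Omega>)))"
    by (simp add: L_def sphere_superlevel_def lemn_image[OF ctx])
  have L': "L = sphere_superlevel (\<lambda>w. root n (cmod (w ^ n + b))) \<mu>"
    by (simp add: L_def absU_def[abs_def] b_def)
  note main = lemniscatic_map_polynomial_preimage[OF ctx assms(1,2) L L' b \<mu>(1)]
  note comp = preimage_components(1)[OF ctx assms(1,2)] branch_disjoint[OF ctx] preimage_eq[OF ctx]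
  show ?thesis using \<mu>(1) main comp unfolding \<Phi> E by blast
qed

end
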